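(* Let $\mathcal C=\{\mathcal C_1,\dots,\mathcal C_K\}$ be a clustering of $\mathcal V=\{1,\dots,n\}$ and let $\Upsilon=\{\mathcal G_1,\dots,\mathcal G_m\}$ be a finite set of directed graphs on $\mathcal V$ such that ($\mathcal A$) for each pair $p,q$ of cluster indices, either there are no links from $\mathcal C_q$ to $\mathcal C_p$ in any $\mathcal G_l$, $l=1,\dots,m$, or for each vertex $v\in\mathcal C_p$ and each $\mathcal G_l$, $l=1,\dots,m$, there is at least one link from $\mathcal C_q$ to $v$ in $\mathcal G_l$. Call a sequence $\{A(t)\}_{t\ge 0}$ of $n\times n$ stochastic matrices admissible with matrix $B$ if $\mathcal G(A(t))\in\Upsilon$ for all $t$ and: ($\mathcal B_1$) there is a constant $e>0$ such that for all $i,j,t$, either $A_{ij}(t)=0$ or $A_{ij}(t)\ge e$; ($\mathcal B_2$) $A_{ii}(t)\ge e$ for all $i=1,\dots,n$ and $t\ge0$; ($\mathcal B_3^*$) $B=[b_{p,q}]_{p,q=1}^K$ is a constant stochastic matrix with $\sum_{j\in\mathcal C_q}A_{ij}(t)=b_{p,q}$ for all $t\ge 0$, all $i\in\mathcal C_p$ and all $p,q=1,\dots,K$; and there exists an integer $L>0$ such that for every $t\ge 0$ the union graph $\mathcal G\big(\sum_{i=t}^{t+L-1}A(i)\big)$ has cluster-spanning-trees with respect to $\mathcal C$. Consider, for an admissible sequence, the system $$x(t+1)=A(t)x(t)+\varsigma u(t),\qquad t\ge 0,$$ where $\varsigma\in\mathbb R^n$, $\varsigma_i=\alpha_p$ for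 $i\in\mathcal C_p$, with $\tilde\varsigma=[\alpha_1,\dots,\alpha_K]^\top\in\mathbb R^K$, and $u:\{0,1,2,\dots\}\to\mathbb R$. (i) If $u(t)$ and $\sum_{k=0}^t u(k)$ are both bounded in $t$, then for any initial data $x(0)\in\mathbb R^n$ the solution $x(t)$ is bounded. (ii) If in addition $u$ is periodic with period $T\ge 2$ and $\sum_{k=1}^{T}u(k)=0$, then the system reaches cluster consensus generically, i.e. for almost every triple $\{B,\tilde\varsigma,[u_1,\dots,u_{T-1}]\}$, for every sequence $\{A(t)\}$ admissible with matrix $B$ and for almost all $x(0)\in\mathbb R^n$, the solution is bounded, intra-cluster synchronizes and inter-cluster separates; and each trajectory converges to a $T$-periodic one, i.e. for each solution $x(t)$ there is a $T$-periodic function $v(t)\in\mathbb R^n$ with $\lim_{t\to\infty}\|x(t)-v(t)\|=0$.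
   Context: A clustering of $\mathcal V=\{1,\dots,n\}$ is a partition $\mathcal C=\{\mathcal C_1,\dots,\mathcal C_K\}$ of $\mathcal V$. A stochastic matrix is a nonnegative square matrix with all row sums equal to $1$. The directed graph $\mathcal G(A)$ of a nonnegative $n\times n$ matrix $A$ has vertex set $\mathcal V$ and has an edge (link) $(j,i)$ from $j$ to $i$ if and only if $A_{ij}>0$. A directed graph on $\mathcal V$ has cluster-spanning-trees with respect to $\mathcal C$ if for each $p$ there is a vertex $v_p\in\mathcal V$ (not necessarily in $\mathcal C_p$) with directed paths (possibly of length $0$, possibly through vertices outside $\mathcal C_p$) from $v_p$ to all vertices of $\mathcal C_p$. In (ii), the triples $\{B,\tilde\varsigma,[u_1,\dots,u_{T-1}]\}$ range over: $B$ a $K\times K$ stochastic matrix with $b_{p,q}>0$ if and only if the graphs in $\Upsilon$ have links from $\mathcal C_q$ to $\mathcal C_p$ (the second alternative of ($\mathcal A$)); $\tilde\varsigma\in\mathbb R^K$; and $[u_1,\dots,u_{T-1}]\in\mathbb R^{T-1}$, which determines $u$ by $u(\theta+kT)=u_\theta$ for $\theta=1,\dots,T-1$ and $u(kT)=-\sum_{j=1}^{T-1}u_j$, for all $k\ge0$. "Almost every" triple means outside a set of Lebesgue measure zero, where the set of such $B$ is given Lebesgue measure on its affine hull; "almost all $x(0)$" is with respect to Lebesgue measure on $\mathbb R^n$. $x(t)$ intra-cluster synchronizes if $\lim_{t\to\infty}|x_i(t)-x_{i'}(t)|=0$ for all $i,i'$ in the same cluster. $x(t)$ inter-cluster separates if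 $\limsup_{t\to\infty}|x_i(t)-x_j(t)|>0$ for every $i\in\mathcal C_k$, $j\in\mathcal C_l$ with $k\neq l$. Cluster consensus means bounded, intra-cluster synchronizing and inter-cluster separating. *)

theory Defs
  imports "HOL-Analysis.Analysis"
begin

definition clustering :: "('k \<Rightarrow> 'n set) \<Rightarrow> bool" where
  "clustering C \<longleftrightarrow> inj C \<and> partition_on UNIV (range C)"

definition stochastic :: "real^'n^'n \<Rightarrow> bool" where
  "stochastic A \<longleftrightarrow> (\<forall>i j. 0 \<le> A $ i $ j) \<and> (\<forall>i. (\<Sum>j\<in>UNIV. A $ i $ j) = 1)"

text \<open>A directed graph on the vertex type is its set of edges, the pair \<open>(j, i)\<close> being an edge
  from \<open>j\<close> to \<open>i\<close>; paths are given by the reflexive transitive closure. Note the index swap between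
  matrix entries and edges.\<close>

definition graph_of :: "real^'n^'n \<Rightarrow> ('n \<times> 'n) set" where
  "graph_of A = {(j, i). A $ i $ j > 0}"

definition cluster_spanning_trees :: "('k \<Rightarrow> 'n set) \<Rightarrow> ('n \<times> 'n) set \<Rightarrow> bool" where
  "cluster_spanning_trees C G \<longleftrightarrow> (\<forall>p. \<exists>v. \<forall>i\<in>C p. (v, i) \<in> G\<^sup>*)"

definition no_links :: "('k \<Rightarrow> 'n set) \<Rightarrow> ('n \<times> 'n) set set \<Rightarrow> 'k \<Rightarrow> 'k \<Rightarrow> bool" where
  "no_links C \<Upsilon> q p \<longleftrightarrow> (\<forall>G\<in>\<Upsilon>. \<forall>w\<in>C q. \<forall>v\<in>C p. (w, v) \<notin> G)"

definition all_linked :: "('k \<Rightarrow> 'n set) \<Rightarrow> ('n \<times> 'n) set set \<Rightarrow> 'k \<Rightarrow> 'k \<Rightarrow> bool" where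
  "all_linked C \<Upsilon> q p \<longleftrightarrow> (\<forall>v\<in>C p. \<forall>G\<in>\<Upsilon>. \<exists>w\<in>C q. (w, v) \<in> G)"

definition common_inter_links :: "('k \<Rightarrow> 'n set) \<Rightarrow> ('n \<times> 'n) set set \<Rightarrow> bool" where
  "common_inter_links C \<Upsilon> \<longleftrightarrow> (\<forall>p q. no_links C \<Upsilon> q p \<or> all_linked C \<Upsilon> q p)"

definition admissible ::
  "('k::finite \<Rightarrow> 'n set) \<Rightarrow> ('n::finite \<times> 'n) set set \<Rightarrow> real^'k^'k \<Rightarrow> (nat \<Rightarrow> real^'n^'n) \<Rightarrow> bool"
where
  "admissible C \<Upsilon> B A \<longleftrightarrow>
     (\<forall>t. stochastic (A t) \<and> graph_of (A t) \<in> \<Upsilon>) \<and>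
     (\<exists>e>0. (\<forall>i j t. A t $ i $ j = 0 \<or> A t $ i $ j \<ge> e) \<and> (\<forall>i t. A t $ i $ i \<ge> e)) \<and>
     stochastic B \<and> (\<forall>t p q. \<forall>i\<in>C p. (\<Sum>j\<in>C q. A t $ i $ j) = B $ p $ q) \<and>
     (\<exists>L>0. \<forall>t. cluster_spanning_trees C (graph_of (\<Sum>s\<in>{t..<t+L}. A s)))"

definition cluster_vector :: "('k::finite \<Rightarrow> 'n set) \<Rightarrow> real^'k \<Rightarrow> real^'n" where
  "cluster_vector C \<alpha> = (\<chi> i. \<alpha> $ (THE p. i \<in> C p))"

primrec solution ::
  "(nat \<Rightarrow> real^'n^'n) \<Rightarrow> real^'n \<Rightarrow> (nat \<Rightarrow> real) \<Rightarrow> real^'n \<Rightarrow> nat \<Rightarrow> real^'n" where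
  "solution A \<sigma> u x0 0 = x0"
| "solution A \<sigma> u x0 (Suc t) = A t *v solution A \<sigma> u x0 t + u t *\<^sub>R \<sigma>"

definition intra_cluster_synchronizes :: "('k \<Rightarrow> 'n set) \<Rightarrow> (nat \<Rightarrow> real^'n) \<Rightarrow> bool" where
  "intra_cluster_synchronizes C x \<longleftrightarrow>
     (\<forall>p. \<forall>i\<in>C p. \<forall>j\<in>C p. (\<lambda>t. \<bar>x t $ i - x t $ j\<bar>) \<longlonglongrightarrow> 0)"

definition inter_cluster_separates :: "('k \<Rightarrow> 'n set) \<Rightarrow> (nat \<Rightarrow> real^'n) \<Rightarrow> bool" where
  "inter_cluster_separates C x \<longleftrightarrow>
     (\<forall>p q. p \<noteq> q \<longrightarrow> (\<forall>i\<in>C p. \<forall>j\<in>C q. limsup (\<lambda>t. ereal \<bar>x t $ i - x t $ j\<bar>) > 0))"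

definition cluster_consensus :: "('k \<Rightarrow> 'n set) \<Rightarrow> (nat \<Rightarrow> real^'n) \<Rightarrow> bool" where
  "cluster_consensus C x \<longleftrightarrow>
     bounded (range x) \<and> intra_cluster_synchronizes C x \<and> inter_cluster_separates C x"

definition pattern_matrices :: "('k::finite \<Rightarrow> 'n set) \<Rightarrow> ('n \<times> 'n) set set \<Rightarrow> (real^'k^'k) set" where
  "pattern_matrices C \<Upsilon> = {B. stochastic B \<and> (\<forall>p q. B $ p $ q > 0 \<longleftrightarrow> all_linked C \<Upsilon> q p)}"

text \<open>The zero-sum input of period \<open>T\<close> determined by its values at the times \<open>1, \<dots>, T - 1\<close>.\<close>

definition periodic_input :: "nat \<Rightarrow> (nat \<Rightarrow> real) \<Rightarrow> nat \<Rightarrow> real" where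
  "periodic_input T w t = (if t mod T = 0 then - (\<Sum>j=1..<T. w j) else w (t mod T))"

text \<open>Lebesgue measure on a nonempty affine subspace \<open>H\<close>: the image of Lebesgue measure on the
  coordinates with respect to an orthonormal basis of the direction space of \<open>H\<close>. By isometry
  invariance the choice of origin and basis is immaterial. On a single point it is the Dirac
  measure. As a Borel measure on the ambient space it is not completed, which does not affect
  \<open>AE\<close> statements.\<close>

definition affine_lborel :: "'a::euclidean_space set \<Rightarrow> 'a measure" where
  "affine_lborel H =
     (let a = (SOME a. a \<in> H);
          E = (SOME E. pairwise orthogonal E \<and> (\<forall>v\<in>E. norm v = 1) \<and>
                 span E = span {x - y | x y. x \<in> H \<and> y \<in> H})
      in distr (\<Pi>\<^sub>M v\<in>E. lborel) borel (\<lambda>f. a + (\<Sum>v\<in>E. f v *\<^sub>R v)))"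

end

theory Submission
  imports Defs
begin

text \<open>By the equal row sums, the system restricted to vectors that are constant on clusters is the
  system \<open>y(t + 1) = B y(t) + u(t) \<alpha>\<close> on \<open>\<real>\<^sup>K\<close>, so a solution is a homogeneous one plus the lifted
  forced response \<open>y\<close> with \<open>y(0) = 0\<close>. In the homogeneous system, over sufficiently many windows any
  two vertices of a cluster acquire a common influencing vertex, whence the intra-cluster spread
  contracts. Since \<open>B\<close> has a positive diagonal, \<open>\<alpha> = n + r\<close> with \<open>B n = n\<close> and \<open>\<Sum>\<^sub>k \<parallel>B\<^sup>k r\<parallel> < \<infinity>\<close>,
  which gives boundedness and the periodic limit.

  For the separation, let \<open>y\<^sup>\<alpha>\<close> be the forced response. From \<open>y\<^sup>\<alpha>(t + 1) = y\<^bsup>B\<alpha>\<^esup>(t) + u(t) \<alpha>\<close> one sees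
  that, whenever \<open>u \<noteq> 0\<close>, the vectors \<open>\<alpha>\<close> for which two components of \<open>y\<^sup>\<alpha>\<close> merge form a proper
  subspace; this holds for every \<open>B\<close>, so only \<open>\<alpha>\<close> and \<open>u\<close> need to be generic. The initial states for
  which two vertices of different clusters merge then form an affine subspace that misses \<open>0\<close>.\<close>

subsection \<open>Powers of stochastic matrices with positive diagonal\<close>

text \<open>The partial sum of length n is at most that of length n + N, hence at most the first N
  terms plus c times itself; solving for it gives a bound uniform in n.\<close>

lemma summable_of_contraction:
  fixes a :: "nat \<Rightarrow> real"
  assumes nonneg: "\<And>k. 0 \<le> a k" and contr: "\<And>k. a (k + N) \<le> c * a k" and c: "c < 1"
  shows "summable a"
proof (rule summableI_nonneg_bounded[OF nonneg])
  fix n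
  have split: "(\<Sum>k<n + N. a k) = (\<Sum>k<N. a k) + (\<Sum>k<n. a (k + N))"
    by (induction n) auto
  have "(\<Sum>k<n. a k) \<le> (\<Sum>k<n + N. a k)"
    by (rule sum_mono2) (auto simp: nonneg)
  also have "\<dots> \<le> (\<Sum>k<N. a k) + c * (\<Sum>k<n. a k)"
    unfolding split sum_distrib_left by (intro add_left_mono sum_mono contr)
  finally have "(\<Sum>k<n. a k) * (1 - c) \<le> (\<Sum>k<N. a k)" by (simp add: algebra_simps)
  then show "(\<Sum>k<n. a k) \<le> (\<Sum>k<N. a k) / (1 - c)"
    using c by (simp add: pos_le_divide_eq)
qed

lemma linear_funpow:
  fixes f :: "'a::real_vector \<Rightarrow> 'a"
  assumes "linear f"
  shows "linear (f ^^ k)"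
proof (induction k)
  case (Suc k)
  then show ?case using linear_compose[OF Suc assms] by (simp add: o_def)
qed (simp add: linear_iff)

text \<open>On the range \<open>R\<close> of \<open>id - f\<close> the map \<open>id - f\<close> is injective, hence a bijection of \<open>R\<close> with
  bounded inverse, so that some power of \<open>f\<close> contracts \<open>R\<close>.\<close>

lemma ergodic_decomposition:
  fixes f :: "'a::euclidean_space \<Rightarrow> 'a"
  assumes f: "linear f" and lim: "\<And>x. (\<lambda>k. (f ^^ k) (x - f x)) \<longlonglongrightarrow> 0"
  obtains n r where "x = n + r" "f n = n" "summable (\<lambda>k. norm ((f ^^ k) r))"
proof -
  define g where "g z = z - f z" for z
  define R where "R = range g"
  have g: "linear g"
    unfolding g_def by (intro linear_compose_sub f linear_id[unfolded id_def])
  have subR: "subspace R"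
    unfolding R_def by (rule linear_subspace_image[OF g subspace_UNIV])
  have fg: "(f ^^ k) (g w) = g ((f ^^ k) w)" for k w
    using linear_diff[OF linear_funpow[OF f]] by (simp add: g_def funpow_swap1)
  \<comment> \<open>An element of R fixed by f has a constant orbit, while \<open>lim\<close> sends
    the orbits of elements of R to 0.\<close>
  have inj0: "r = 0" if r: "r \<in> R" "g r = 0" for r
  proof -
    from r have "f r = r" by (simp add: g_def)
    then have "(f ^^ k) r = r" for k by (induction k) auto
    moreover obtain w where "r = w - f w" using r(1) by (auto simp: R_def g_def)
    ultimately have "(\<lambda>k::nat. r) \<longlonglongrightarrow> 0" using lim[of w] by simp
    then show ?thesis by (simp add: LIMSEQ_const_iff)
  qed
  have "inj_on g R"
    by (rule linear_inj_on_iff_eq_0[THEN iffD2, OF g subR]) (use inj0 in blast)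
  then have dimeq: "dim (g ` R) = dim R"
    by (metis g dim_image_eq span_eq_iff subR)
  have gR: "g ` R = R"
    by (rule subspace_dim_equal)
      (use dimeq subR linear_subspace_image[OF g subR] in \<open>auto simp: R_def\<close>)
  obtain e where e: "e > 0" "\<And>r. r \<in> R \<Longrightarrow> e * norm r \<le> norm (g r)"
    using injective_imp_isometric[of R g] inj0 subR closed_subspace g linear_conv_bounded_linear
    by metis
  \<comment> \<open>\<open>s k\<close> bounds the operator norm of \<open>f ^^ k\<close> after
    \<open>g\<close>; it tends to 0 as a finite sum of null sequences.\<close>
  define s where "s k = (\<Sum>b\<in>Basis. norm ((f ^^ k) (g b)))" for k
  have "s \<longlonglongrightarrow> (\<Sum>b\<in>(Basis::'a set). 0)"
    unfolding s_def using lim by (intro tendsto_sum tendsto_norm_zero) (auto simp: g_def)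
  then have "\<forall>\<^sub>F k in sequentially. s k < e / 2"
    using e by (intro order_tendstoD(2)) auto
  then obtain N where N: "s N < e / 2"
    by (auto simp: eventually_sequentially)
  have bound: "norm ((f ^^ N) (g w)) \<le> s N * norm w" for w
  proof -
    have lin: "linear (\<lambda>w. (f ^^ N) (g w))"
      using linear_compose[OF g linear_funpow[OF f, of N]] by (simp add: o_def)
    have "(f ^^ N) (g w) = (\<Sum>b\<in>Basis. (w \<bullet> b) *\<^sub>R (f ^^ N) (g b))"
      by (subst euclidean_representation[of w, symmetric])
        (simp add: linear_sum[OF lin] linear_scale[OF lin])
    also have "norm \<dots> \<le> (\<Sum>b\<in>Basis. norm w * norm ((f ^^ N) (g b)))"
      by (rule sum_norm_le) (auto intro!: mult_right_mono Basis_le_norm)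
    finally show ?thesis by (simp add: s_def sum_distrib_left mult.commute)
  qed
  \<comment> \<open>As g maps R onto R, r = g w with w in R and e * norm w \<le> norm r; the choice
    of N then leaves the factor 1 / 2.\<close>
  have half: "norm ((f ^^ N) r) \<le> 1 / 2 * norm r" if "r \<in> R" for r
  proof -
    obtain w where w: "w \<in> R" "r = g w" using \<open>r \<in> R\<close> gR by blast
    have "norm ((f ^^ N) r) \<le> s N * norm w" using bound w by simp
    also have "\<dots> \<le> e / 2 * norm w" using N by (intro mult_right_mono) auto
    also have "\<dots> \<le> 1 / 2 * norm r" using e(2)[of w] w by simp
    finally show ?thesis .
  qed
  have inv: "(f ^^ k) r \<in> R" if "r \<in> R" for k r
    using that fg by (auto simp: R_def)
  \<comment> \<open>Since g R = R, the value g x is also attained on R, and x differs from that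
    preimage by a fixed point of f.\<close>
  obtain r where r: "r \<in> R" "g r = g x"
    using gR by (metis R_def imageE rangeI)
  show thesis
  proof
    show "x = (x - r) + r" by simp
    have "g (x - r) = 0" using r linear_diff[OF g] by simp
    then show "f (x - r) = x - r" by (simp add: g_def)
    show "summable (\<lambda>k. norm ((f ^^ k) r))"
    proof (rule summable_of_contraction[of _ N "1 / 2"])
      show "norm ((f ^^ (k + N)) r) \<le> 1 / 2 * norm ((f ^^ k) r)" for k
        using half[OF inv[OF r(1)], of k] by (simp add: funpow_add add.commute)
    qed auto
  qed
qed

lemma stochastic_bounded:
  assumes "stochastic A" and "\<And>i. \<bar>x $ i\<bar> \<le> c"
  shows "\<bar>(A *v x) $ i\<bar> \<le> c"
proof -
  have "\<bar>(A *v x) $ i\<bar> \<le> (\<Sum>j\<in>UNIV. A $ i $ j * c)"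
    unfolding matrix_vector_mult_def vec_lambda_beta
    using assms by (intro sum_abs[THEN order_trans] sum_mono)
      (auto simp: abs_mult stochastic_def intro!: mult_left_mono)
  also have "\<dots> = c"
    using assms(1) by (simp add: sum_distrib_right[symmetric] stochastic_def)
  finally show ?thesis .
qed

text \<open>The maximum norm of the increments of the orbit of y decreases to some c. If c were
  positive, the diagonal weight d would force one component to move by at least c / 2 in the same
  direction N times running, although the orbit stays within [-M, M].\<close>

lemma stochastic_power_differences:
  fixes B :: "real^'k^'k"
  assumes B: "stochastic B" and d: "0 < d" "\<And>p. d \<le> B $ p $ p"
  shows "(\<lambda>k. (((*v) B) ^^ k) (y - B *v y)) \<longlonglongrightarrow> 0"
proof -
  define f where "f = ((*v) B)"
  define a where "a k = (f ^^ k) (y - f y)" for k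
  define m where "m k = Max (range (\<lambda>p. \<bar>a k $ p\<bar>))" for k
  define M where "M = Max (range (\<lambda>p. \<bar>y $ p\<bar>))"
  have f: "linear f" by (simp add: f_def matrix_vector_mul_linear)
  have am: "\<bar>a k $ p\<bar> \<le> m k" for k p
    unfolding m_def by (rule Max_ge) auto
  have m0: "0 \<le> m k" for k
    using am[of k undefined] by simp
  have attained: "\<exists>p. \<bar>a k $ p\<bar> = m k" for k
  proof -
    have "m k \<in> range (\<lambda>p. \<bar>a k $ p\<bar>)" unfolding m_def by (rule Max_in) auto
    then show ?thesis by auto
  qed
  have step: "a (Suc k) = B *v a k" for k by (simp add: a_def f_def)
  have "m (Suc k) \<le> m k" for k
    using attained[of "Suc k"] stochastic_bounded[OF B am, of k] by (metis step)
  then have dec: "decseq m" by (rule decseq_SucI)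
  obtain c where c: "m \<longlonglongrightarrow> c" "\<And>k. c \<le> m k"
    using decseq_convergent[OF dec, of 0] m0 by auto
  have yM: "\<bar>(f ^^ k) y $ p\<bar> \<le> M" for k p
  proof (induction k arbitrary: p)
    case 0
    show ?case unfolding M_def by (auto intro: Max_ge)
  next
    case (Suc k)
    then show ?case using stochastic_bounded[OF B, of "(f ^^ k) y" M] by (simp add: f_def)
  qed
  have a_eq: "a k = (f ^^ k) y - (f ^^ Suc k) y" for k
    unfolding a_def using linear_diff[OF linear_funpow[OF f]] by (simp add: funpow_swap1)
  have "c = 0"
  proof (rule ccontr)
    assume "c \<noteq> 0"
    moreover have "0 \<le> c" using LIMSEQ_le_const[OF c(1)] m0 by auto
    ultimately have c0: "0 < c" by simp
    \<comment> \<open>N moves of size c / 2 exceed 2 M, the largest possible displacement of a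
      component.\<close>
    obtain N :: nat where N: "real N * (c / 2) > 2 * M"
      using c0 by (metis ex_less_of_nat_mult half_gt_zero)
    have d1: "d \<le> 1"
    proof -
      have "B $ p $ p \<le> (\<Sum>q\<in>UNIV. B $ p $ q)" for p
        using B by (intro member_le_sum) (auto simp: stochastic_def)
      then show ?thesis using B d(2) by (metis order_trans stochastic_def)
    qed
    \<comment> \<open>Going back one step enlarges the gap below c + e by a factor of at most 1 / d;
      with this e the gap after N steps is still at most c / 2.\<close>
    define e where "e = c / 2 * d ^ N"
    have e0: "0 < e" using c0 d by (simp add: e_def)
    have "\<forall>\<^sub>F k in sequentially. m k < c + e"
      using c(1) e0 by (intro order_tendstoD(2)) auto
    then obtain k where k: "\<And>i. i \<ge> k \<Longrightarrow> m i < c + e" by (auto simp: eventually_sequentially)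
    obtain p where p: "\<bar>a (k + N) $ p\<bar> = m (k + N)" using attained by blast
    define \<sigma> where "\<sigma> = sgn (a (k + N) $ p)"
    have \<sigma>: "\<bar>\<sigma>\<bar> \<le> 1" by (simp add: \<sigma>_def abs_sgn_eq)
    have top: "c \<le> \<sigma> * a (k + N) $ p"
      using p c(2)[of "k + N"] by (simp add: \<sigma>_def sgn_mult_self_eq abs_sgn mult.commute)
    \<comment> \<open>The new value at p is an average with weight at least d on the old value at p,
      and all old signed values are at most c + e. A value near c + e thus forces the preceding
      value at p to be near it as well.\<close>
    have descend: "c - e * ((1 / d) ^ j - 1) \<le> \<sigma> * a (k + (N - j)) $ p" if "j \<le> N" for j
      using that
    proof (induction j)
      case 0
      then show ?case using top by simp
    next
      case (Suc j)
      define i where "i = k + (N - Suc j)"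
      have i: "k + (N - j) = Suc i" using Suc.prems by (simp add: i_def)
      have ub: "\<sigma> * a i $ q \<le> c + e" for q
      proof -
        have "\<bar>\<sigma> * a i $ q\<bar> \<le> 1 * m i"
          unfolding abs_mult by (intro mult_mono \<sigma> am) auto
        also have "\<dots> \<le> c + e" using k[of i] by (simp add: i_def)
        finally show ?thesis by simp
      qed
      have "\<sigma> * a (Suc i) $ p = (\<Sum>q\<in>UNIV. B $ p $ q * (\<sigma> * a i $ q))"
        by (simp add: step matrix_vector_mult_def sum_distrib_left ac_simps)
      also have "\<dots> = B $ p $ p * (\<sigma> * a i $ p) + (\<Sum>q\<in>-{p}. B $ p $ q * (\<sigma> * a i $ q))"
        by (subst sum.remove[of _ p]) (auto simp: Compl_eq_Diff_UNIV)
      also have "(\<Sum>q\<in>-{p}. B $ p $ q * (\<sigma> * a i $ q)) \<le> (\<Sum>q\<in>-{p}. B $ p $ q * (c + e))"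
        using B ub by (intro sum_mono mult_left_mono) (auto simp: stochastic_def)
      also have "\<dots> = (1 - B $ p $ p) * (c + e)"
      proof -
        have "(\<Sum>q\<in>UNIV. B $ p $ q) = B $ p $ p + (\<Sum>q\<in>-{p}. B $ p $ q)"
          by (subst sum.remove[of _ p]) (auto simp: Compl_eq_Diff_UNIV)
        then show ?thesis using B by (simp add: sum_distrib_right[symmetric] stochastic_def)
      qed
      finally have "\<sigma> * a (Suc i) $ p \<le> c + e - B $ p $ p * (c + e - \<sigma> * a i $ p)"
        by (simp add: algebra_simps)
      also have "\<dots> \<le> c + e - d * (c + e - \<sigma> * a i $ p)"
        using d(2)[of p] ub[of p] by (intro diff_left_mono mult_right_mono) auto
      finally have "c - e * ((1 / d) ^ j - 1) \<le> c + e - d * (c + e - \<sigma> * a i $ p)"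
        using Suc i by simp
      then have "d * (c + e - \<sigma> * a i $ p) \<le> e * (1 / d) ^ j" by (simp add: algebra_simps)
      then have "c + e - \<sigma> * a i $ p \<le> e * (1 / d) ^ j / d"
        using d by (simp add: pos_le_divide_eq mult.commute)
      then show ?case by (simp add: i_def[symmetric] algebra_simps)
    qed
    have low: "c / 2 \<le> \<sigma> * a (k + i) $ p" if "i < N" for i
    proof -
      have "e * (1 / d) ^ (N - i) \<le> e * (1 / d) ^ N"
        using d1 d e0 by (intro mult_left_mono power_increasing) auto
      also have "\<dots> = c / 2" using d by (simp add: e_def power_one_over)
      finally have "c / 2 \<le> c - e * ((1 / d) ^ (N - i) - 1)"
        using e0 by (simp add: algebra_simps)
      then show ?thesis using descend[of "N - i"] that by simp
    qed
    have "real N * (c / 2) \<le> (\<Sum>i<N. \<sigma> * a (k + i) $ p)"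
      using sum_bounded_below[of "{..<N}" "c / 2" "\<lambda>i. \<sigma> * a (k + i) $ p"] low by simp
    \<comment> \<open>By \<open>a_eq\<close> the increments telescope along the orbit.\<close>
    also have "\<dots> = \<sigma> * ((f ^^ k) y $ p - (f ^^ (k + N)) y $ p)"
      by (induction N) (auto simp: a_eq algebra_simps)
    also have "\<dots> \<le> \<bar>\<sigma> * ((f ^^ k) y $ p - (f ^^ (k + N)) y $ p)\<bar>" by simp
    also have "\<dots> \<le> 1 * (M + M)"
      unfolding abs_mult
      by (intro mult_mono \<sigma> abs_triangle_ineq4[THEN order_trans] add_mono yM) auto
    finally show False using N by simp
  qed
  then have "m \<longlonglongrightarrow> 0" using c(1) by simp
  then have "(\<lambda>k. a k $ p) \<longlonglongrightarrow> 0" for p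
    by (rule Lim_null_comparison[rotated]) (simp add: am)
  then have "a \<longlonglongrightarrow> 0" by (intro vec_tendstoI) simp
  then show ?thesis unfolding a_def f_def .
qed

subsection \<open>Contraction of the intra-cluster spread\<close>

lemma stochastic_mat_1: "stochastic (mat 1 :: real^'n^'n)"
  by (auto simp: stochastic_def mat_def)

lemma stochastic_mult:
  assumes "stochastic P" "stochastic Q"
  shows "stochastic (P ** Q)"
proof -
  have "(\<Sum>j\<in>UNIV. (P ** Q) $ i $ j) = (\<Sum>l\<in>UNIV. P $ i $ l * (\<Sum>j\<in>UNIV. Q $ l $ j))" for i
    unfolding matrix_matrix_mult_def by (simp add: sum_distrib_left) (rule sum.swap)
  then show ?thesis
    using assms by (auto simp: stochastic_def matrix_matrix_mult_def intro!: sum_nonneg)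
qed

lemma matrix_mult_pos:
  fixes P Q :: "real^'n^'n"
  assumes "\<And>i j. 0 \<le> P $ i $ j" "\<And>i j. 0 \<le> Q $ i $ j" "0 < P $ i $ l" "0 < Q $ l $ j"
  shows "0 < (P ** Q) $ i $ j"
  unfolding matrix_matrix_mult_def using assms
  by (auto intro!: sum_pos2[of UNIV l])

section \<open>Clusterings and vectors that are constant on clusters\<close>

lemma clustering_unique:
  assumes C: "clustering C" and i: "i \<in> C p" "i \<in> C q"
  shows "p = q"
proof (rule injD)
  show "inj C" using C by (simp add: clustering_def)
  have "disjoint (range C)" using C by (simp add: clustering_def partition_on_def)
  then show "C p = C q" using disjointD[of "range C" "C p" "C q"] i by blast
qed

lemma cluster_vector_nth:
  assumes C: "clustering C" and i: "i \<in> C p"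
  shows "cluster_vector C y $ i = y $ p"
proof -
  have "(THE p. i \<in> C p) = p"
    by (rule the_equality) (fact i, rule clustering_unique[OF C _ i])
  then show ?thesis by (simp add: cluster_vector_def)
qed

lemma clustering_cover:
  assumes "clustering C"
  obtains p where "i \<in> C p"
proof -
  have "\<Union> (range C) = UNIV" using assms by (simp add: clustering_def partition_on_def)
  then have "i \<in> \<Union> (range C)" by simp
  then show thesis using that by blast
qed

lemma clustering_nonempty:
  assumes "clustering C"
  shows "C p \<noteq> {}"
proof
  assume "C p = {}"
  then have "{} \<in> range C" by (metis rangeI)
  moreover have "{} \<notin> range C" using assms by (simp add: clustering_def partition_on_def)
  ultimately show False by simp
qed

lemma cluster_vector_eqI:
  assumes "clustering C" "\<And>p i. i \<in> C p \<Longrightarrow> x $ i = y $ p"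
  shows "x = cluster_vector C y"
  unfolding vec_eq_iff using assms by (metis clustering_cover cluster_vector_nth)

lemma cluster_vector_add: "cluster_vector C (x + y) = cluster_vector C x + cluster_vector C y"
  by (simp add: cluster_vector_def vec_eq_iff)

lemma cluster_vector_scaleR: "cluster_vector C (c *\<^sub>R x) = c *\<^sub>R cluster_vector C x"
  by (simp add: cluster_vector_def vec_eq_iff)

lemma bounded_linear_cluster_vector:
  "bounded_linear (cluster_vector C :: real^'k::finite \<Rightarrow> real^'n::finite)"
  unfolding linear_conv_bounded_linear[symmetric]
  by (intro linearI cluster_vector_add cluster_vector_scaleR)

text \<open>Against a vector constant on clusters, a row of A only matters through its cluster sums,
  which form a row of B. This links the system on vertices to the reduced one.\<close>

lemma matrix_cluster_vector:
  fixes A :: "real^'n::finite^'n" and C :: "'k::finite \<Rightarrow> 'n set"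
  assumes C: "clustering C"
    and sums: "\<And>p q i. i \<in> C p \<Longrightarrow> (\<Sum>j\<in>C q. A $ i $ j) = B $ p $ q"
  shows "A *v cluster_vector C y = cluster_vector C (B *v y)"
proof (rule cluster_vector_eqI[OF C])
  fix p i assume i: "i \<in> C p"
  have "(A *v cluster_vector C y) $ i = (\<Sum>j\<in>(\<Union>q. C q). A $ i $ j * cluster_vector C y $ j)"
  proof -
    have "(\<Union>q. C q) = UNIV" using C by (auto simp: clustering_def partition_on_def)
    then show ?thesis by (simp add: matrix_vector_mult_def)
  qed
  also have "\<dots> = (\<Sum>q\<in>UNIV. \<Sum>j\<in>C q. A $ i $ j * cluster_vector C y $ j)"
  proof (rule sum.UNION_disjoint)
    show "\<forall>p\<in>UNIV. \<forall>q\<in>UNIV. p \<noteq> q \<longrightarrow> C p \<inter> C q = {}"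
      using clustering_unique[OF C] by blast
  qed auto
  also have "\<dots> = (\<Sum>q\<in>UNIV. (\<Sum>j\<in>C q. A $ i $ j) * y $ q)"
    by (simp add: cluster_vector_nth[OF C] sum_distrib_right)
  also have "\<dots> = (B *v y) $ p"
    using sums[OF i] by (simp add: matrix_vector_mult_def)
  finally show "(A *v cluster_vector C y) $ i = (B *v y) $ p" .
qed

section \<open>The largest oscillation of a vector within a cluster\<close>

definition spread :: "('k \<Rightarrow> 'n::finite set) \<Rightarrow> real^'n \<Rightarrow> real" where
  "spread C x = Max ((\<lambda>(i, j). \<bar>x $ i - x $ j\<bar>) ` {(i, j). \<exists>p. i \<in> C p \<and> j \<in> C p})"

lemma spread_upper: "i \<in> C p \<Longrightarrow> j \<in> C p \<Longrightarrow> \<bar>x $ i - x $ j\<bar> \<le> spread C x"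
  unfolding spread_def by (rule Max_ge) auto

lemma spread_least:
  assumes "clustering C" "\<And>p i j. i \<in> C p \<Longrightarrow> j \<in> C p \<Longrightarrow> \<bar>x $ i - x $ j\<bar> \<le> d"
  shows "spread C x \<le> d"
  unfolding spread_def
proof (rule Max.boundedI)
  obtain p where "undefined \<in> C p" using assms(1) by (rule clustering_cover)
  then show "(\<lambda>(i, j). \<bar>x $ i - x $ j\<bar>) ` {(i, j). \<exists>p. i \<in> C p \<and> j \<in> C p} \<noteq> {}" by auto
qed (use assms in auto)

lemma spread_nonneg:
  assumes "clustering C"
  shows "0 \<le> spread C x"
proof -
  obtain p where "undefined \<in> C p" using assms by (rule clustering_cover)
  then show ?thesis using spread_upper[of undefined C p undefined x] by simp
qed

text \<open>Since \<open>M\<close> preserves the vectors that are constant on clusters, the cluster minima can be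
  subtracted from \<open>x\<close> before two rows are compared.\<close>

lemma spread_contraction:
  fixes M :: "real^'n::finite^'n" and C :: "'k::finite \<Rightarrow> 'n set"
  assumes C: "clustering C" and M: "stochastic M"
    and inv: "\<And>y. \<exists>z. M *v cluster_vector C y = cluster_vector C z"
    and overlap: "\<And>p i i'. i \<in> C p \<Longrightarrow> i' \<in> C p \<Longrightarrow> \<exists>j. d \<le> M $ i $ j \<and> d \<le> M $ i' $ j"
  shows "spread C (M *v x) \<le> (1 - d) * spread C x"
proof -
  define c where "c = (\<chi> q. Min ((\<lambda>j. x $ j) ` C q))"
  define y where "y = x - cluster_vector C c"
  obtain z where z: "M *v cluster_vector C c = cluster_vector C z" using inv by blast
  have y: "0 \<le> y $ j \<and> y $ j \<le> spread C x" for j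
  proof -
    obtain q where q: "j \<in> C q" using C by (rule clustering_cover)
    have "c $ q \<in> (\<lambda>j. x $ j) ` C q"
      unfolding c_def vec_lambda_beta using q by (intro Min_in) auto
    then obtain l where l: "l \<in> C q" "c $ q = x $ l" by auto
    have "c $ q \<le> x $ j" unfolding c_def vec_lambda_beta using q by (intro Min_le) auto
    then show ?thesis
      using spread_upper[of j C q l x, OF q l(1)] l by (simp add: y_def cluster_vector_nth[OF C q])
  qed
  have diff: "(M *v x) $ i - (M *v x) $ i' \<le> (1 - d) * spread C x"
    if i: "i \<in> C p" "i' \<in> C p" for i i' p
  proof -
    obtain l where l: "d \<le> M $ i $ l" "d \<le> M $ i' $ l" using overlap[OF i] by blast
    have nonneg: "0 \<le> M $ a $ b" for a b using M by (simp add: stochastic_def)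
    have "(M *v x) $ i - (M *v x) $ i' = (M *v y) $ i - (M *v y) $ i'"
      using i by (simp add: y_def matrix_vector_mult_diff_distrib z cluster_vector_nth[OF C])
    also have "\<dots> = (\<Sum>j\<in>UNIV. (M $ i $ j - M $ i' $ j) * y $ j)"
      by (simp add: matrix_vector_mult_def sum_subtractf left_diff_distrib)
    \<comment> \<open>Each difference of entries is replaced by its positive part, which is allowed
      because y is nonnegative; the positive parts sum to one minus the overlap of the two
      rows.\<close>
    also have "\<dots> \<le> (\<Sum>j\<in>UNIV. (M $ i $ j - min (M $ i $ j) (M $ i' $ j)) * spread C x)"
    proof (rule sum_mono)
      fix j
      have "(M $ i $ j - M $ i' $ j) * y $ j \<le> (M $ i $ j - min (M $ i $ j) (M $ i' $ j)) * y $ j"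
        using y by (intro mult_right_mono) auto
      also have "\<dots> \<le> (M $ i $ j - min (M $ i $ j) (M $ i' $ j)) * spread C x"
        using y by (intro mult_left_mono) auto
      finally show "(M $ i $ j - M $ i' $ j) * y $ j
          \<le> (M $ i $ j - min (M $ i $ j) (M $ i' $ j)) * spread C x" .
    qed
    also have "\<dots> = (1 - (\<Sum>j\<in>UNIV. min (M $ i $ j) (M $ i' $ j))) * spread C x"
      using M by (simp add: sum_distrib_right[symmetric] sum_subtractf stochastic_def)
    also have "\<dots> \<le> (1 - d) * spread C x"
    proof -
      have "min (M $ i $ l) (M $ i' $ l) \<le> (\<Sum>j\<in>UNIV. min (M $ i $ j) (M $ i' $ j))"
        using nonneg by (intro member_le_sum) auto
      then show ?thesis using l spread_nonneg[OF C] by (intro mult_right_mono) auto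
    qed
    finally show ?thesis .
  qed
  show ?thesis
  proof (rule spread_least[OF C])
    show "\<bar>(M *v x) $ i - (M *v x) $ j\<bar> \<le> (1 - d) * spread C x"
      if "i \<in> C p" "j \<in> C p" for p i j
      using diff[OF that] diff[OF that(2,1)] by (simp add: abs_le_iff)
  qed
qed

section \<open>Transition matrices and the influence between vertices\<close>

text \<open>The product A(s + k - 1) ... A(s), which carries the state at time s to time s + k. The
  recursion splits off the factor that acts first; \<open>transition_Suc\<close> splits off the last
  one.\<close>

primrec transition :: "(nat \<Rightarrow> real^'n^'n) \<Rightarrow> nat \<Rightarrow> nat \<Rightarrow> real^'n^'n" where
  "transition A 0 s = mat 1"
| "transition A (Suc k) s = transition A k (Suc s) ** A s"

lemma transition_add:
  "transition A (j + k) s = transition A j (s + k) ** transition A k s"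
  by (induction k arbitrary: s) (auto simp: matrix_mul_assoc)

lemma transition_Suc: "transition A (Suc k) s = A (s + k) ** transition A k s"
  using transition_add[of A 1 k s] by simp

lemma solution_homogeneous:
  "solution (\<lambda>t. A (s + t)) 0 u x k = transition A k s *v x"
  by (induction k) (auto simp: transition_Suc matrix_vector_mul_assoc simp del: transition.simps(2))

lemma stochastic_transition:
  assumes "\<And>t. stochastic (A t)"
  shows "stochastic (transition A k s)"
  by (induction k arbitrary: s) (auto intro: stochastic_mat_1 stochastic_mult assms)

lemma transition_cluster_vector:
  assumes "\<And>t y. A t *v cluster_vector C y = cluster_vector C (B *v y)"
  shows "transition A k s *v cluster_vector C y = cluster_vector C ((((*v) B) ^^ k) y)"
  by (induction k)
    (auto simp: transition_Suc matrix_vector_mul_assoc[symmetric] assms simp del: transition.simps(2))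

text \<open>A nonzero entry of the product has a nonzero summand, at least e^k * e, and no summand
  is negative. The bound is independent of s, which makes the later contraction factor uniform in
  time.\<close>

lemma transition_entry:
  assumes stoch: "\<And>t. stochastic (A t)" and e: "0 < e" "\<And>t i j. A t $ i $ j = 0 \<or> e \<le> A t $ i $ j"
  shows "transition A k s $ i $ j = 0 \<or> e ^ k \<le> transition A k s $ i $ j"
proof (induction k arbitrary: s i j)
  case 0
  show ?case by (simp add: mat_def)
next
  case (Suc k)
  let ?g = "\<lambda>l. transition A k (Suc s) $ i $ l * A s $ l $ j"
  have nonneg: "0 \<le> ?g l" for l
    using stoch stochastic_transition[of A, OF stoch, of k "Suc s"] by (simp add: stochastic_def)
  show ?case
  proof (cases "\<exists>l. ?g l \<noteq> 0")
    case True
    then obtain l where l: "?g l \<noteq> 0" by blast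
    have "e ^ k * e \<le> ?g l"
      using l Suc[of "Suc s" i l] e(2)[of s l j] e(1)
        stochastic_transition[of A, OF stoch, of k "Suc s"]
      by (intro mult_mono) (auto simp: stochastic_def)
    also have "\<dots> \<le> (\<Sum>l\<in>UNIV. ?g l)" using nonneg by (intro member_le_sum) auto
    finally show ?thesis by (simp add: matrix_matrix_mult_def mult.commute)
  next
    case False
    then have "(\<Sum>l\<in>UNIV. ?g l) = 0" by (intro sum.neutral) blast
    then show ?thesis by (simp add: matrix_matrix_mult_def)
  qed
qed

lemma transition_diagonal_pos:
  assumes stoch: "\<And>t. stochastic (A t)" and diag: "\<And>t i. 0 < A t $ i $ i"
  shows "0 < transition A k s $ i $ i"
proof (induction k arbitrary: s)
  case (Suc k)
  then show ?case
    using stochastic_transition[of A, OF stoch, of k "Suc s"] stoch diag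
    by (auto simp: stochastic_def intro!: matrix_mult_pos)
qed (simp add: mat_def)

text \<open>The positive diagonal permits waiting: influence stays at j until the edge occurs in the
  window, crosses it, and stays at i for the remaining steps.\<close>

lemma transition_union_graph_pos:
  assumes stoch: "\<And>t. stochastic (A t)" and diag: "\<And>t i. 0 < A t $ i $ i"
    and edge: "(j, i) \<in> graph_of (\<Sum>t\<in>{s..<s + L}. A t)"
  shows "0 < transition A L s $ i $ j"
proof -
  have nonneg: "0 \<le> transition A k t $ a $ b" "0 \<le> A t $ a $ b" for k t a b
    using stoch stochastic_transition[of A, OF stoch] by (simp_all add: stochastic_def)
  have "0 < (\<Sum>t\<in>{s..<s + L}. A t $ i $ j)"
    using edge by (simp add: graph_of_def sum_component)
  then obtain t where t: "t \<in> {s..<s + L}" "0 < A t $ i $ j"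
    by (metis less_le_not_le linorder_not_le sum_nonpos)
  define a where "a = t - s"
  have a: "L = (L - Suc a) + Suc a" "t = s + a" using t by (auto simp: a_def)
  have "0 < transition A (Suc a) s $ i $ j"
    unfolding transition_Suc using t a transition_diagonal_pos[of A, OF stoch diag] nonneg
    by (intro matrix_mult_pos[of _ _ i j]) (auto simp del: transition.simps)
  then show ?thesis
    using transition_diagonal_pos[of A, OF stoch diag] nonneg
    by (subst a(1), subst transition_add) (intro matrix_mult_pos[of _ _ i i], auto simp del: transition.simps)
qed

lemma rtrancl_enters:
  assumes "(v, i) \<in> G\<^sup>*" "v \<notin> S" "i \<in> S"
  obtains a b where "(a, b) \<in> G" "a \<notin> S" "b \<in> S"
proof -
  have "\<exists>a b. (a, b) \<in> G \<and> a \<notin> S \<and> b \<in> S"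
    using assms by (induction rule: rtrancl_induct) blast+
  then show thesis using that by blast
qed

text \<open>Going back one window, the set of vertices that influence \<open>i\<close> gains all its predecessors in
  the union graph. As long as the sets for \<open>i\<close> and \<open>i'\<close> are disjoint, one of them misses the
  common root and hence grows.\<close>

lemma influence_sets_grow:
  fixes A :: "nat \<Rightarrow> real^'n::finite^'n"
  assumes stoch: "\<And>t. stochastic (A t)" and diag: "\<And>t i. 0 < A t $ i $ i"
    and trees: "\<And>t. cluster_spanning_trees C (graph_of (\<Sum>s\<in>{t..<t + L}. A s))"
    and i: "i \<in> C p" "i' \<in> C p"
  defines "S \<equiv> \<lambda>m s i. {j. 0 < transition A (m * L) s $ i $ j}"
  shows "S m s i \<inter> S m s i' \<noteq> {} \<or> m \<le> card (S m s i) + card (S m s i')"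
proof (induction m arbitrary: s)
  case (Suc m)
  define G where "G = graph_of (\<Sum>t\<in>{s..<s + L}. A t)"
  have nonneg: "0 \<le> transition A k t $ a $ b" for k t a b
    using stochastic_transition[of A, OF stoch] by (simp add: stochastic_def)
  have eq: "transition A (Suc m * L) s = transition A (m * L) (s + L) ** transition A L s"
    using transition_add[of A "m * L" L s] by (simp add: add.commute)
  have extend: "a \<in> S (Suc m) s k" if "b \<in> S m (s + L) k" "0 < transition A L s $ b $ a" for a b k
    using that unfolding S_def eq by (auto intro: matrix_mult_pos nonneg)
  have mono: "S m (s + L) k \<subseteq> S (Suc m) s k" for k
    using extend transition_diagonal_pos[of A, OF stoch diag] by blast
  \<comment> \<open>The set contains k itself by the positive diagonal, so a path from outside to k
    enters it along some edge, and the tail of this edge joins the set.\<close>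
  have grow: "card (S m (s + L) k) < card (S (Suc m) s k)"
    if path: "(v, k) \<in> G\<^sup>*" "v \<notin> S m (s + L) k" for v k
  proof -
    have k: "k \<in> S m (s + L) k"
      using transition_diagonal_pos[of A, OF stoch diag] by (simp add: S_def)
    obtain a b where "(a, b) \<in> G" "a \<notin> S m (s + L) k" "b \<in> S m (s + L) k"
      using rtrancl_enters[OF path k] by blast
    then have "a \<in> S (Suc m) s k" "a \<notin> S m (s + L) k"
      using extend transition_union_graph_pos[of A, OF stoch diag] unfolding G_def by blast+
    then have "S m (s + L) k \<subset> S (Suc m) s k" using mono by blast
    then show ?thesis by (intro psubset_card_mono) auto
  qed
  have le: "card (S m (s + L) k) \<le> card (S (Suc m) s k)" for k
    by (intro card_mono mono) auto
  show ?case
  proof (cases "S m (s + L) i \<inter> S m (s + L) i' = {}")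
    case False
    then show ?thesis using mono by blast
  next
    case True
    obtain v where v: "(v, i) \<in> G\<^sup>*" "(v, i') \<in> G\<^sup>*"
      using trees[of s] i unfolding cluster_spanning_trees_def G_def by blast
    have "v \<notin> S m (s + L) i \<or> v \<notin> S m (s + L) i'" using True by blast
    then have "card (S m (s + L) i) + card (S m (s + L) i') < card (S (Suc m) s i) + card (S (Suc m) s i')"
      using grow[OF v(1)] grow[OF v(2)] le[of i] le[of i'] by linarith
    then show ?thesis using Suc[of "s + L"] True by linarith
  qed
qed simp

section \<open>Consequences of admissibility\<close>

lemma admissibleD:
  assumes A: "admissible C \<Upsilon> B A" and C: "clustering C"
  shows "stochastic (A t)" and "stochastic B" and "0 < A t $ i $ i"
    and "A t *v cluster_vector C y = cluster_vector C (B *v y)"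
proof -
  show "stochastic (A t)" "stochastic B" using A unfolding admissible_def by blast+
  obtain e where "0 < e" "e \<le> A t $ i $ i" using A unfolding admissible_def by blast
  then show "0 < A t $ i $ i" by simp
  show "A t *v cluster_vector C y = cluster_vector C (B *v y)"
    using A unfolding admissible_def by (intro matrix_cluster_vector[OF C]) blast
qed

text \<open>\<open>B $ p $ p\<close> is the sum of the row of a vertex of C p over its own cluster,
  hence dominates the diagonal entry there. This is what keeps the powers of B from
  oscillating.\<close>

lemma admissible_diagonal:
  assumes A: "admissible C \<Upsilon> B A" and C: "clustering C"
  shows "\<exists>d>0. \<forall>p. d \<le> B $ p $ p"
proof -
  obtain e where e: "0 < e" "\<And>i. e \<le> A 0 $ i $ i"
  proof -
    obtain e where "0 < e" "\<forall>i t. e \<le> A t $ i $ i"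
      using A unfolding admissible_def by blast
    then show ?thesis using that by blast
  qed
  have "e \<le> B $ p $ p" for p
  proof -
    obtain i where i: "i \<in> C p" using clustering_nonempty[OF C] by blast
    have "A 0 $ i $ i \<le> (\<Sum>j\<in>C p. A 0 $ i $ j)"
      using i admissibleD(1)[OF A C] by (intro member_le_sum) (auto simp: stochastic_def)
    also have "\<dots> = B $ p $ p" using A i unfolding admissible_def by blast
    finally show ?thesis using e(2)[of i] by simp
  qed
  then show ?thesis using e by blast
qed

text \<open>Every N steps multiply the spread by at most 1 - e^N, so that it is even
  summable.\<close>

lemma homogeneous_spread_tendsto_0:
  fixes A :: "nat \<Rightarrow> real^'n::finite^'n"
  assumes A: "admissible C \<Upsilon> B A" and C: "clustering C"
  shows "(\<lambda>t. spread C (transition A t 0 *v x)) \<longlonglongrightarrow> 0"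
proof -
  note stoch = admissibleD(1)[OF A C] and diag = admissibleD(3)[OF A C]
  obtain e where e: "0 < e" "\<And>t i j. A t $ i $ j = 0 \<or> e \<le> A t $ i $ j"
    using A unfolding admissible_def by blast
  obtain L where L: "\<And>t. cluster_spanning_trees C (graph_of (\<Sum>s\<in>{t..<t + L}. A s))"
    using A unfolding admissible_def by blast
  \<comment> \<open>One window more than there are vertices: disjoint influence sets would have
    total size at least n + 1 inside a set of n vertices.\<close>
  define N where "N = Suc (CARD('n)) * L"
  have "\<exists>j. e ^ N \<le> transition A N s $ i $ j \<and> e ^ N \<le> transition A N s $ i' $ j"
    if i: "i \<in> C p" "i' \<in> C p" for p i i' s
  proof -
    define S where "S i = {j. 0 < transition A N s $ i $ j}" for i
    have "S i \<inter> S i' \<noteq> {}"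
    proof
      assume "S i \<inter> S i' = {}"
      then have "card (S i) + card (S i') = card (S i \<union> S i')"
        by (intro card_Un_disjoint[symmetric]) auto
      also have "\<dots> \<le> CARD('n)" by (intro card_mono) auto
      finally show False
        using influence_sets_grow[of A C L, OF stoch diag L i, of "Suc (CARD('n))" s] \<open>S i \<inter> S i' = {}\<close>
        unfolding S_def N_def by linarith
    qed
    then obtain j where "j \<in> S i" "j \<in> S i'" by blast
    then show ?thesis
      using transition_entry[of A e, OF stoch e, of N s i j] transition_entry[of A e, OF stoch e, of N s i' j]
      by (auto simp: S_def)
  qed
  then have "spread C (transition A N t *v y) \<le> (1 - e ^ N) * spread C y" for t y
    using transition_cluster_vector[of A C B, OF admissibleD(4)[OF A C]]
    by (intro spread_contraction[OF C stochastic_transition[of A, OF stoch]]) blast+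
  then have "spread C (transition A (t + N) 0 *v x) \<le> (1 - e ^ N) * spread C (transition A t 0 *v x)" for t
    using transition_add[of A N t 0] by (simp add: matrix_vector_mul_assoc[symmetric] add.commute)
  then have "summable (\<lambda>t. spread C (transition A t 0 *v x))"
    using e by (intro summable_of_contraction[of _ N "1 - e ^ N"] spread_nonneg[OF C]) auto
  then show ?thesis by (rule summable_LIMSEQ_zero)
qed

subsection \<open>Boundedness and asymptotic periodicity\<close>

lemma solution_add:
  "solution A (\<sigma> + \<tau>) u (x + y) t = solution A \<sigma> u x t + solution A \<tau> u y t"
  by (induction t) (simp_all add: matrix_vector_right_distrib scaleR_add_right)

lemma solution_cluster_vector:
  assumes "\<And>t y. A t *v cluster_vector C y = cluster_vector C (B *v y)"
  shows "solution A (cluster_vector C \<alpha>) u (cluster_vector C y) t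
    = cluster_vector C (solution (\<lambda>_. B) \<alpha> u y t)"
  by (induction t) (simp_all add: assms cluster_vector_add cluster_vector_scaleR)

text \<open>The solution is jointly linear in the input direction and the initial state, so the pair
  splits into (0, x) and (lifted \<alpha>, 0); the second part is the lift of a reduced
  solution.\<close>

lemma solution_decomposition:
  fixes A :: "nat \<Rightarrow> real^'n::finite^'n" and C :: "'k::finite \<Rightarrow> 'n set"
  assumes A: "admissible C \<Upsilon> B A" and C: "clustering C"
  shows "solution A (cluster_vector C \<alpha>) u x t
    = transition A t 0 *v x + cluster_vector C (solution (\<lambda>_. B) \<alpha> u 0 t)"
proof -
  have "cluster_vector C 0 = (0 :: real^'n)"
    by (simp add: cluster_vector_def vec_eq_iff)
  then have "solution A (cluster_vector C \<alpha>) u x t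
      = solution A 0 u x t + solution A (cluster_vector C \<alpha>) u (cluster_vector C 0) t"
    using solution_add[of A 0 "cluster_vector C \<alpha>" u x 0 t] by simp
  also have "solution A 0 u x t = transition A t 0 *v x"
    using solution_homogeneous[of A 0 u x t] by simp
  also have "solution A (cluster_vector C \<alpha>) u (cluster_vector C 0) t
      = cluster_vector C (solution (\<lambda>_. B) \<alpha> u 0 t)"
    by (rule solution_cluster_vector) (rule admissibleD(4)[OF A C])
  finally show ?thesis .
qed

lemma admissible_ergodic_decomposition:
  assumes A: "admissible C \<Upsilon> B A" and C: "clustering C"
  obtains n r where "\<alpha> = n + r" "B *v n = n" "summable (\<lambda>k. norm ((((*v) B) ^^ k) r))"
proof -
  obtain d where d: "d > 0" "\<And>p. d \<le> B $ p $ p"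
    using admissible_diagonal[OF A C] by blast
  show thesis
    using ergodic_decomposition[OF matrix_vector_mul_linear, of B \<alpha>]
      stochastic_power_differences[OF admissibleD(2)[OF A C] d] that by blast
qed

text \<open>The response is the convolution of u with the powers of B. On the fixed part n it
  collapses to partial sums of u; on r the kernel will be summable.\<close>

lemma forced_response:
  fixes B :: "real^'k::finite^'k"
  assumes "B *v n = n"
  shows "solution (\<lambda>_. B) (n + r) u 0 t
    = (\<Sum>s<t. u s) *\<^sub>R n + (\<Sum>k<t. u (t - Suc k) *\<^sub>R (((*v) B) ^^ k) r)"
proof (induction t)
  case (Suc t)
  have "(\<Sum>k<Suc t. u (Suc t - Suc k) *\<^sub>R (((*v) B) ^^ k) r)
      = u t *\<^sub>R r + B *v (\<Sum>k<t. u (t - Suc k) *\<^sub>R (((*v) B) ^^ k) r)"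
    by (simp only: sum.lessThan_Suc_shift)
      (simp add: linear_sum[OF matrix_vector_mul_linear] matrix_vector_mult_scaleR)
  then show ?case
    using Suc assms
    by (simp add: matrix_vector_right_distrib matrix_vector_mult_scaleR algebra_simps)
qed simp

lemma homogeneous_bounded:
  fixes A :: "nat \<Rightarrow> real^'n::finite^'n"
  assumes "\<And>t. stochastic (A t)"
  shows "bounded (range (\<lambda>t. transition A t 0 *v x))"
proof -
  have "norm (transition A t 0 *v x) \<le> (\<Sum>i\<in>(UNIV::'n set). norm x)" for t
    by (rule order_trans[OF norm_le_l1_cart])
      (intro sum_mono stochastic_bounded stochastic_transition assms component_le_norm_cart)
  then show ?thesis by (intro boundedI) auto
qed

lemma solution_bounded:
  assumes A: "admissible C \<Upsilon> B A" and C: "clustering C"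
    and u: "bounded (range u)" "bounded (range (\<lambda>t. \<Sum>k\<le>t. u k))"
  shows "bounded (range (solution A (cluster_vector C \<alpha>) u x0))"
proof -
  obtain n r where nr: "\<alpha> = n + r" "B *v n = n" "summable (\<lambda>k. norm ((((*v) B) ^^ k) r))"
    using admissible_ergodic_decomposition[OF A C] by blast
  obtain K where K: "\<And>t. \<bar>u t\<bar> \<le> K" using u(1) by (auto simp: bounded_iff)
  obtain M where M: "\<And>t. \<bar>\<Sum>k\<le>t. u k\<bar> \<le> M" using u(2) by (auto simp: bounded_iff)
  have M': "\<bar>\<Sum>k<t. u k\<bar> \<le> M" for t
  proof (cases t)
    case 0
    then show ?thesis using M[of 0] by simp
  next
    case (Suc s)
    then show ?thesis using M[of s] by (simp add: lessThan_Suc_atMost)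
  qed
  have K0: "0 \<le> K" using K[of 0] by simp
  have "norm (solution (\<lambda>_. B) \<alpha> u 0 t) \<le> M * norm n + K * (\<Sum>k. norm ((((*v) B) ^^ k) r))" for t
    unfolding nr(1) forced_response[OF nr(2)]
  proof (rule norm_triangle_le[OF add_mono])
    show "norm ((\<Sum>s<t. u s) *\<^sub>R n) \<le> M * norm n"
      using M' by (simp add: mult_right_mono)
    have "norm (\<Sum>k<t. u (t - Suc k) *\<^sub>R (((*v) B) ^^ k) r)
        \<le> (\<Sum>k<t. K * norm ((((*v) B) ^^ k) r))"
      by (rule sum_norm_le) (simp add: mult_right_mono K)
    also have "\<dots> \<le> K * (\<Sum>k. norm ((((*v) B) ^^ k) r))"
      unfolding sum_distrib_left[symmetric]
      by (intro mult_left_mono sum_le_suminf nr(3) K0) auto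
    finally show "norm (\<Sum>k<t. u (t - Suc k) *\<^sub>R (((*v) B) ^^ k) r)
        \<le> K * (\<Sum>k. norm ((((*v) B) ^^ k) r))" .
  qed
  then have "bounded (range (solution (\<lambda>_. B) \<alpha> u 0))" by (intro boundedI) auto
  from bounded_linear_image[OF this bounded_linear_cluster_vector]
  have "bounded (range (\<lambda>t. cluster_vector C (solution (\<lambda>_. B) \<alpha> u 0 t)))"
    by (simp add: image_image)
  with homogeneous_bounded[of A x0, OF admissibleD(1)[OF A C]] show ?thesis
    by (subst solution_decomposition[OF A C, abs_def]) (intro bounded_plus_comp)
qed

text \<open>The lifted forced response is constant on clusters and cancels in the difference,
  leaving the homogeneous part, which the spread controls.\<close>

lemma solution_intra_cluster_synchronizes:
  assumes A: "admissible C \<Upsilon> B A" and C: "clustering C"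
  shows "intra_cluster_synchronizes C (solution A (cluster_vector C \<alpha>) u x)"
  unfolding intra_cluster_synchronizes_def
proof (intro allI ballI)
  fix p i j assume ij: "i \<in> C p" "j \<in> C p"
  show "(\<lambda>t. \<bar>solution A (cluster_vector C \<alpha>) u x t $ i - solution A (cluster_vector C \<alpha>) u x t $ j\<bar>)
      \<longlonglongrightarrow> 0"
  proof (rule Lim_null_comparison[OF _ homogeneous_spread_tendsto_0[OF A C, of x]])
    show "\<forall>\<^sub>F t in sequentially.
        norm \<bar>solution A (cluster_vector C \<alpha>) u x t $ i - solution A (cluster_vector C \<alpha>) u x t $ j\<bar>
        \<le> spread C (transition A t 0 *v x)"
      using spread_upper[of i C p j] ij
      by (simp add: solution_decomposition[OF A C] cluster_vector_nth[OF C])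
  qed
qed

text \<open>From a late time on, the state is up to a small error constant on clusters; that part evolves
  by powers of \<open>B\<close>, which converge, and the error does not grow.\<close>

lemma homogeneous_convergent:
  fixes A :: "nat \<Rightarrow> real^'n::finite^'n"
  assumes A: "admissible C \<Upsilon> B A" and C: "clustering C"
  shows "convergent (\<lambda>t. transition A t 0 *v x)"
proof -
  define h where "h t = transition A t 0 *v x" for t
  have "Cauchy (\<lambda>t. h t $ i)" for i
  proof (rule metric_CauchyI)
    fix e :: real assume e: "e > 0"
    have "\<forall>\<^sub>F t in sequentially. spread C (h t) < e / 4"
      unfolding h_def using homogeneous_spread_tendsto_0[OF A C] e
      by (intro order_tendstoD(2)) auto
    then obtain s where s: "spread C (h s) < e / 4" by (auto simp: eventually_sequentially)
    \<comment> \<open>The state at time s is approximated by its value at one representative of each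
      cluster, with error d at most the spread.\<close>
    define z where "z = (\<chi> p. h s $ (SOME i. i \<in> C p))"
    define d where "d = h s - cluster_vector C z"
    have d: "\<bar>d $ i\<bar> \<le> spread C (h s)" for i
    proof -
      obtain p where p: "i \<in> C p" using C by (rule clustering_cover)
      have "(SOME i. i \<in> C p) \<in> C p" using p by (rule someI)
      then show ?thesis
        using spread_upper[of i C p "SOME i. i \<in> C p" "h s"] p
        by (simp add: d_def z_def cluster_vector_nth[OF C p])
    qed
    obtain n r where nr: "z = n + r" "B *v n = n" "summable (\<lambda>k. norm ((((*v) B) ^^ k) r))"
      using admissible_ergodic_decomposition[OF A C] by blast
    define g where "g k = cluster_vector C ((((*v) B) ^^ k) z) $ i" for k
    have "(((*v) B) ^^ k) n = n" for k using nr(2) by (induction k) auto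
    then have zk: "(((*v) B) ^^ k) z = n + (((*v) B) ^^ k) r" for k
      unfolding nr(1) by (simp add: linear_add[OF linear_funpow[OF matrix_vector_mul_linear]])
    have "(\<lambda>k. (((*v) B) ^^ k) r) \<longlonglongrightarrow> 0"
      using summable_LIMSEQ_zero[OF nr(3)] by (simp add: tendsto_norm_zero_iff)
    then have "(\<lambda>k. (((*v) B) ^^ k) z) \<longlonglongrightarrow> n + 0" unfolding zk by (intro tendsto_intros)
    then have "g \<longlonglongrightarrow> cluster_vector C (n + 0) $ i"
      unfolding g_def by (intro tendsto_vec_nth bounded_linear.tendsto[OF bounded_linear_cluster_vector])
    then have "Cauchy g" by (rule LIMSEQ_imp_Cauchy)
    then obtain K where K: "\<And>k l. K \<le> k \<Longrightarrow> K \<le> l \<Longrightarrow> dist (g k) (g l) < e / 4"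
      using e by (meson metric_CauchyD divide_pos_pos zero_less_numeral)
    have hg: "\<bar>h (k + s) $ i - g k\<bar> < e / 4" for k
    proof -
      have "h (k + s) = transition A k s *v h s"
        using transition_add[of A k s 0] by (simp add: h_def matrix_vector_mul_assoc)
      also have "\<dots> = transition A k s *v cluster_vector C z + transition A k s *v d"
        by (simp add: d_def matrix_vector_right_distrib[symmetric])
      also have "transition A k s *v cluster_vector C z = cluster_vector C ((((*v) B) ^^ k) z)"
        by (rule transition_cluster_vector) (rule admissibleD(4)[OF A C])
      finally have "h (k + s) $ i - g k = (transition A k s *v d) $ i" by (simp add: g_def)
      moreover have "\<bar>(transition A k s *v d) $ i\<bar> \<le> spread C (h s)"
        by (intro stochastic_bounded stochastic_transition admissibleD(1)[OF A C] d)
      ultimately show ?thesis using s by simp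
    qed
    show "\<exists>M. \<forall>m\<ge>M. \<forall>l\<ge>M. dist (h m $ i) (h l $ i) < e"
    proof (intro exI allI impI)
      fix m l assume "K + s \<le> m" "K + s \<le> l"
      then have "m - s + s = m" "l - s + s = l" "K \<le> m - s" "K \<le> l - s" by auto
      then have "\<bar>h m $ i - g (m - s)\<bar> < e / 4" "\<bar>h l $ i - g (l - s)\<bar> < e / 4"
          "\<bar>g (m - s) - g (l - s)\<bar> < e / 4"
        using hg[of "m - s"] hg[of "l - s"] K[of "m - s" "l - s"] by (simp_all add: dist_real_def)
      then show "dist (h m $ i) (h l $ i) < e" using e unfolding dist_real_def by linarith
    qed
  qed
  then have "\<exists>l. (\<lambda>t. h t $ i) \<longlonglongrightarrow> l" for i
    by (simp add: Cauchy_convergent_iff convergent_def)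
  then obtain l where "\<And>i. (\<lambda>t. h t $ i) \<longlonglongrightarrow> l i" by metis
  then have "h \<longlonglongrightarrow> (\<chi> i. l i)" by (intro vec_tendstoI) simp
  then show ?thesis unfolding h_def convergent_def by blast
qed

section \<open>Periodic inputs and the periodic limit\<close>

lemma periodic_mult:
  assumes "\<And>t. g (t + T) = g t"
  shows "g (t + T * m) = g (t::nat)"
proof (induction m)
  case (Suc m)
  then show ?case using assms[of "t + T * m"] by (simp add: algebra_simps)
qed simp

lemma periodic_bounded:
  fixes g :: "nat \<Rightarrow> real"
  assumes g: "\<And>t. g (t + T) = g t" and T: "0 < T"
  shows "bounded (range g)"
proof -
  have "g t = g (t mod T)" for t
    using periodic_mult[of g T "t mod T" "t div T", OF g] by simp
  then have "g t \<in> g ` {..<T}" for t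
    using T by (metis image_eqI lessThan_iff mod_less_divisor)
  then have "range g \<subseteq> g ` {..<T}" by blast
  then show ?thesis by (rule finite_imp_bounded[OF finite_subset]) simp
qed

lemma periodic_partial_sums:
  fixes u :: "nat \<Rightarrow> real"
  assumes u: "\<And>t. u (t + T) = u t" and zero: "(\<Sum>k=1..T. u k) = 0"
  shows "(\<Sum>s<t + T. u s) = (\<Sum>s<t. u s)"
proof (induction t)
  case 0
  \<comment> \<open>The hypothesis sums over 1, ..., T, the claim over 0, ..., T - 1; the two agree
    because u 0 = u T.\<close>
  have "(\<Sum>k=1..T. u k) = (\<Sum>k<T. u (Suc k))"
    using sum.shift_bounds_Suc_ivl[of u 0 T] by (simp add: atLeastLessThanSuc_atLeastAtMost atLeast0LessThan)
  moreover have "u 0 + (\<Sum>k<T. u (Suc k)) = (\<Sum>k<T. u k) + u T"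
    by (simp flip: sum.lessThan_Suc_shift)
  ultimately show ?case using zero u[of 0] by simp
next
  case (Suc t)
  then show ?case using u[of t] by simp
qed

text \<open>The limit w extends the convolution with r to an infinite series, as if the periodic
  input had acted forever. The error is a tail of a summable series, and the homogeneous part
  converges to a constant l.\<close>

lemma solution_asymptotically_periodic:
  fixes A :: "nat \<Rightarrow> real^'n::finite^'n" and C :: "'k::finite \<Rightarrow> 'n set"
  assumes A: "admissible C \<Upsilon> B A" and C: "clustering C" and T: "0 < T"
    and u: "\<And>t. u (t + T) = u t" and zero: "(\<Sum>k=1..T. u k) = 0"
  shows "\<exists>v. (\<forall>t. v (t + T) = v t) \<and>
    (\<lambda>t. norm (solution A (cluster_vector C \<alpha>) u x0 t - v t)) \<longlonglongrightarrow> 0"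
proof -
  obtain n r where nr: "\<alpha> = n + r" "B *v n = n" "summable (\<lambda>k. norm ((((*v) B) ^^ k) r))"
    using admissible_ergodic_decomposition[OF A C] by blast
  obtain K where K: "\<And>t. \<bar>u t\<bar> \<le> K"
    using periodic_bounded[of u, OF u T] by (auto simp: bounded_iff)
  obtain l where l: "(\<lambda>t. transition A t 0 *v x0) \<longlonglongrightarrow> l"
    using homogeneous_convergent[OF A C] by (auto simp: convergent_def)
  define b where "b k = norm ((((*v) B) ^^ k) r)" for k
  \<comment> \<open>a nonnegative representative of the time \<open>t - 1 - k\<close> modulo \<open>T\<close>\<close>
  define g where "g t k = u (t + (T - 1) * Suc k) *\<^sub>R (((*v) B) ^^ k) r" for t k
  define w where "w t = (\<Sum>s<t. u s) *\<^sub>R n + (\<Sum>k. g t k)" for t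
  have g_le: "norm (g t k) \<le> K * b k" for t k
    by (simp add: g_def b_def mult_right_mono K)
  have sumb: "summable b" using nr(3) by (simp add: b_def[abs_def])
  have sumg: "summable (g t)" for t
    by (rule summable_comparison_test'[of "\<lambda>k. K * b k" 0]) (auto intro: summable_mult sumb g_le)
  have w_periodic: "w (t + T) = w t" for t
  proof -
    have "g (t + T) k = g t k" for k
      using u[of "t + (T - 1) * Suc k"] by (simp add: g_def algebra_simps)
    then show ?thesis using periodic_partial_sums[of u, OF u zero] by (simp add: w_def)
  qed
  have diff: "norm (solution (\<lambda>_. B) \<alpha> u 0 t - w t) \<le> K * (suminf b - (\<Sum>k<t. b k))" for t
  proof -
    have "u (t - Suc k) *\<^sub>R (((*v) B) ^^ k) r = g t k" if "k < t" for k
    proof -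
      \<comment> \<open>For k < t the time used in \<open>g\<close> is the true time t - Suc k plus
        a multiple of T.\<close>
      have "t + (T - 1) * Suc k = (t - Suc k) + T * Suc k"
        using that T by (cases T) (auto simp: algebra_simps)
      then show ?thesis
        using periodic_mult[of u T "t - Suc k" "Suc k", OF u] by (simp only: g_def)
    qed
    then have "solution (\<lambda>_. B) \<alpha> u 0 t - w t = - (suminf (g t) - (\<Sum>k<t. g t k))"
      unfolding nr(1) forced_response[OF nr(2)] w_def by simp
    also have "\<dots> = - (\<Sum>k. g t (k + t))"
      using suminf_minus_initial_segment[OF sumg] by simp
    also have "norm \<dots> \<le> (\<Sum>k. K * b (k + t))"
      unfolding norm_minus_cancel
      by (intro norm_suminf_le g_le summable_mult summable_ignore_initial_segment[OF sumb])
    also have "\<dots> = K * (suminf b - (\<Sum>k<t. b k))"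
      using suminf_minus_initial_segment[OF sumb, of t]
      by (simp add: suminf_mult[OF summable_ignore_initial_segment[OF sumb]])
    finally show ?thesis .
  qed
  have "(\<lambda>t. K * (suminf b - (\<Sum>k<t. b k))) \<longlonglongrightarrow> K * (suminf b - suminf b)"
    by (intro tendsto_intros summable_LIMSEQ sumb)
  then have "(\<lambda>t. K * (suminf b - (\<Sum>k<t. b k))) \<longlonglongrightarrow> 0" by simp
  with always_eventually[OF allI[OF diff]]
  have "(\<lambda>t. solution (\<lambda>_. B) \<alpha> u 0 t - w t) \<longlonglongrightarrow> 0"
    by (rule Lim_null_comparison)
  from bounded_linear.tendsto[OF bounded_linear_cluster_vector[of C] this]
  have "(\<lambda>t. cluster_vector C (solution (\<lambda>_. B) \<alpha> u 0 t) - cluster_vector C (w t)) \<longlonglongrightarrow> (0::real^'n)"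
    by (simp add: linear_diff[OF bounded_linear.linear[OF bounded_linear_cluster_vector]]
        linear_0[OF bounded_linear.linear[OF bounded_linear_cluster_vector]])
  moreover have "(\<lambda>t. transition A t 0 *v x0 - l) \<longlonglongrightarrow> 0"
    using l by (simp add: LIM_zero)
  ultimately have "(\<lambda>t. (transition A t 0 *v x0 - l)
      + (cluster_vector C (solution (\<lambda>_. B) \<alpha> u 0 t) - cluster_vector C (w t))) \<longlonglongrightarrow> 0 + 0"
    by (intro tendsto_add)
  then have "(\<lambda>t. norm (solution A (cluster_vector C \<alpha>) u x0 t - (l + cluster_vector C (w t)))) \<longlonglongrightarrow> 0"
    by (simp add: solution_decomposition[OF A C] tendsto_norm_zero algebra_simps)
  then show ?thesis
    using w_periodic by (intro exI[of _ "\<lambda>t. l + cluster_vector C (w t)"]) simp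
qed

subsection \<open>Generic separation\<close>

lemma periodic_input_periodic: "periodic_input T w (t + T) = periodic_input T w t"
  by (simp add: periodic_input_def)

lemma periodic_input_zero_sum:
  assumes "0 < T"
  shows "(\<Sum>k=1..T. periodic_input T w k) = 0"
proof -
  have "{1..T} = insert T {1..<T}" using assms by auto
  then have "(\<Sum>k=1..T. periodic_input T w k)
      = periodic_input T w T + (\<Sum>k=1..<T. periodic_input T w k)" by simp
  also have "(\<Sum>k=1..<T. periodic_input T w k) = (\<Sum>k=1..<T. w k)"
    by (intro sum.cong) (auto simp: periodic_input_def)
  finally show ?thesis by (simp add: periodic_input_def)
qed

text \<open>A nonempty proper affine subspace is a translate of a subspace of smaller dimension,
  hence negligible.\<close>

lemma AE_lborel_not_in_affine:
  fixes S :: "'a::euclidean_space set"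
  assumes S: "affine S" and proper: "S \<noteq> UNIV"
  shows "AE x in lborel. x \<notin> S"
proof (cases "S = {}")
  case False
  then obtain a where a: "a \<in> S" by blast
  define V where "V = (\<lambda>x. (-a) + x) ` S"
  have V: "subspace V" unfolding V_def by (rule affine_diffs_subspace[OF S a])
  have SV: "S = (\<lambda>x. a + x) ` V" by (simp add: V_def image_image)
  have "V \<noteq> UNIV"
  proof
    assume "V = UNIV"
    then have "S = UNIV" unfolding SV by (simp add: surj_plus)
    then show False using proper by blast
  qed
  then have "dim V \<noteq> DIM('a)"
    using V by (metis dim_eq_full span_eq_iff)
  then have "negligible V"
    using dim_subset_UNIV[of V] by (intro negligible_lowdim) linarith
  then have "negligible S" unfolding SV by (rule negligible_translation)
  then have "AE x in lebesgue. x \<notin> S"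
    by (intro AE_not_in) (simp add: negligible_iff_null_sets)
  then show ?thesis by (simp add: AE_completion_iff)
qed simp

text \<open>The liminf is nonnegative, so a limsup of at most 0 forces both to be 0. The limit form
  exposes linear structure, the limsup form measurability.\<close>

lemma limsup_abs_pos_iff:
  fixes g :: "nat \<Rightarrow> real"
  shows "0 < limsup (\<lambda>t. ereal \<bar>g t\<bar>) \<longleftrightarrow> \<not> g \<longlonglongrightarrow> 0"
proof -
  have nonneg: "0 \<le> liminf (\<lambda>t. ereal \<bar>g t\<bar>)" by (intro Liminf_bounded) auto
  have le: "liminf (\<lambda>t. ereal \<bar>g t\<bar>) \<le> limsup (\<lambda>t. ereal \<bar>g t\<bar>)"
    by (rule Liminf_le_Limsup) simp
  have "limsup (\<lambda>t. ereal \<bar>g t\<bar>) \<le> 0 \<longleftrightarrow> (\<lambda>t. ereal \<bar>g t\<bar>) \<longlonglongrightarrow> 0"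
  proof
    assume "limsup (\<lambda>t. ereal \<bar>g t\<bar>) \<le> 0"
    then show "(\<lambda>t. ereal \<bar>g t\<bar>) \<longlonglongrightarrow> 0"
      using nonneg le by (auto simp: tendsto_iff_Liminf_eq_Limsup intro: antisym order_trans)
  next
    assume "(\<lambda>t. ereal \<bar>g t\<bar>) \<longlonglongrightarrow> 0"
    then show "limsup (\<lambda>t. ereal \<bar>g t\<bar>) \<le> 0"
      by (simp add: lim_imp_Limsup)
  qed
  also have "\<dots> \<longleftrightarrow> g \<longlonglongrightarrow> 0"
    by (simp add: zero_ereal_def tendsto_rabs_zero_iff)
  finally show ?thesis by auto
qed

lemma cluster_solution_commute:
  "solution (\<lambda>_. B) (B *v \<alpha>) u 0 t = B *v solution (\<lambda>_. B) \<alpha> u 0 t"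
  by (induction t) (simp_all add: matrix_vector_right_distrib matrix_vector_mult_scaleR)

lemma cluster_solution_scaleR:
  "solution (\<lambda>_. B) (c *\<^sub>R \<alpha>) u 0 t = c *\<^sub>R solution (\<lambda>_. B) \<alpha> u 0 t"
  by (induction t) (simp_all add: matrix_vector_mult_scaleR scaleR_add_right mult.commute)

text \<open>If the components \<open>p\<close> and \<open>q\<close> of the responses to \<open>\<alpha>\<close> and \<open>B \<alpha>\<close> both merge, then so do those
  of \<open>u(t) \<alpha>\<close>, because \<open>y\<^sup>\<alpha>(t + 1) = y\<^bsup>B\<alpha>\<^esup>(t) + u(t) \<alpha>\<close>. Hence the merging vectors \<open>\<alpha>\<close> form a proper
  subspace.\<close>

lemma AE_forced_response_separates:
  fixes B :: "real^'k::finite^'k"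
  assumes pq: "p \<noteq> q" and u: "\<And>t. u (t + T) = u t" and T: "0 < T" and u1: "u 1 \<noteq> 0"
  shows "AE \<alpha> in lborel. \<not> (\<lambda>t. solution (\<lambda>_. B) \<alpha> u 0 t $ p - solution (\<lambda>_. B) \<alpha> u 0 t $ q) \<longlonglongrightarrow> 0"
proof -
  define y where "y \<alpha> t = solution (\<lambda>_. B) \<alpha> u 0 t $ p - solution (\<lambda>_. B) \<alpha> u 0 t $ q" for \<alpha> t
  define S where "S = {\<alpha>. y \<alpha> \<longlonglongrightarrow> 0}"
  have add: "y (\<alpha> + \<beta>) = (\<lambda>t. y \<alpha> t + y \<beta> t)" for \<alpha> \<beta>
    using solution_add[of "\<lambda>_. B" \<alpha> \<beta> u 0 0] by (auto simp: y_def)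
  have scale: "y (c *\<^sub>R \<alpha>) = (\<lambda>t. c * y \<alpha> t)" for c \<alpha>
    by (auto simp: y_def cluster_solution_scaleR algebra_simps)
  have "subspace S"
  proof (rule subspaceI)
    show "0 \<in> S" using scale[of 0 0] by (simp add: S_def)
    show "\<alpha> + \<beta> \<in> S" if "\<alpha> \<in> S" "\<beta> \<in> S" for \<alpha> \<beta>
      using tendsto_add[of "y \<alpha>" 0 sequentially "y \<beta>" 0] that by (simp add: S_def add)
    show "c *\<^sub>R \<alpha> \<in> S" if "\<alpha> \<in> S" for c \<alpha>
      using tendsto_mult[of "\<lambda>_. c" c sequentially "y \<alpha>" 0] that
      by (simp add: S_def scale)
  qed
  then have "affine S" by (rule subspace_imp_affine)
  moreover have "S \<noteq> UNIV"
  proof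
    assume "S = UNIV"
    then have lim: "y \<alpha> \<longlonglongrightarrow> 0" for \<alpha> by (auto simp: S_def)
    \<comment> \<open>For this unit vector the components p and q of u(t) \<alpha> differ by exactly
      u(t), so u itself would tend to 0; the times 1 + T m refute this.\<close>
    define \<alpha> where "\<alpha> = (axis p 1 :: real^'k)"
    have "y \<alpha> (Suc t) - y (B *v \<alpha>) t = u t" for t
      using pq by (simp add: y_def cluster_solution_commute \<alpha>_def axis_def)
    moreover have "(\<lambda>t. y \<alpha> (Suc t) - y (B *v \<alpha>) t) \<longlonglongrightarrow> 0 - 0"
      by (intro tendsto_diff lim LIMSEQ_Suc)
    ultimately have "u \<longlonglongrightarrow> 0" by simp
    moreover have "strict_mono (\<lambda>m. 1 + T * m)" using T by (simp add: strict_mono_def)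
    ultimately have "(u \<circ> (\<lambda>m. 1 + T * m)) \<longlonglongrightarrow> 0" by (rule LIMSEQ_subseq_LIMSEQ)
    then have "(\<lambda>m::nat. u 1) \<longlonglongrightarrow> 0"
      using periodic_mult[of u T 1, OF u] by (simp only: o_def)
    then show False using u1 by (simp add: LIMSEQ_const_iff)
  qed
  ultimately have "AE \<alpha> in lborel. \<alpha> \<notin> S" by (rule AE_lborel_not_in_affine)
  then show ?thesis by (simp add: S_def y_def[abs_def])
qed

lemma AE_solution_separates:
  fixes A :: "nat \<Rightarrow> real^'n::finite^'n"
  assumes A: "admissible C \<Upsilon> B A" and C: "clustering C" and ij: "i \<in> C p" "j \<in> C q"
    and y: "\<not> (\<lambda>t. solution (\<lambda>_. B) \<alpha> u 0 t $ p - solution (\<lambda>_. B) \<alpha> u 0 t $ q) \<longlonglongrightarrow> 0"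
  shows "AE x in lborel. \<not> (\<lambda>t. solution A (cluster_vector C \<alpha>) u x t $ i
    - solution A (cluster_vector C \<alpha>) u x t $ j) \<longlonglongrightarrow> 0"
proof -
  define z where "z x t = solution A (cluster_vector C \<alpha>) u x t $ i
    - solution A (cluster_vector C \<alpha>) u x t $ j" for x t
  define S where "S = {x. z x \<longlonglongrightarrow> 0}"
  \<comment> \<open>The forced term is independent of x, so only combinations with c + d = 1
    preserve it.\<close>
  have comb: "z (c *\<^sub>R x + d *\<^sub>R x') = (\<lambda>t. c * z x t + d * z x' t)" if "c + d = 1" for c d x x'
  proof
    have d: "d = 1 - c" using that by simp
    show "z (c *\<^sub>R x + d *\<^sub>R x') t = c * z x t + d * z x' t" for t unfolding d
      by (simp add: z_def solution_decomposition[OF A C] matrix_vector_right_distrib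
          matrix_vector_mult_scaleR algebra_simps)
  qed
  have "affine S"
    unfolding affine_def
  proof (intro ballI allI impI)
    fix x x' c d assume *: "x \<in> S" "x' \<in> S" "c + d = (1::real)"
    then have "(\<lambda>t. c * z x t + d * z x' t) \<longlonglongrightarrow> c * 0 + d * 0"
      by (intro tendsto_intros) (simp_all add: S_def)
    then show "c *\<^sub>R x + d *\<^sub>R x' \<in> S"
      using comb[OF *(3)] by (simp add: S_def)
  qed
  \<comment> \<open>From x = 0 the solution is the lifted forced response, whose components p and q
    do not merge.\<close>
  moreover have "0 \<notin> S"
    using y ij by (simp add: S_def z_def[abs_def] solution_decomposition[OF A C] cluster_vector_nth[OF C])
  ultimately have "AE x in lborel. x \<notin> S" by (intro AE_lborel_not_in_affine) auto
  then show ?thesis by (simp add: S_def z_def[abs_def])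
qed

text \<open>The condition depends on the triple alone and not on A, so that one null set of triples
  serves all admissible sequences at once.\<close>

definition separates :: "real^'k^'k \<Rightarrow> real^'k \<Rightarrow> (nat \<Rightarrow> real) \<Rightarrow> bool" where
  "separates B \<alpha> u \<longleftrightarrow> (\<forall>p q. p \<noteq> q \<longrightarrow>
    0 < limsup (\<lambda>t. ereal \<bar>solution (\<lambda>_. B) \<alpha> u 0 t $ p - solution (\<lambda>_. B) \<alpha> u 0 t $ q\<bar>))"

lemma separatesD:
  "separates B \<alpha> u \<Longrightarrow> p \<noteq> q \<Longrightarrow>
    \<not> (\<lambda>t. solution (\<lambda>_. B) \<alpha> u 0 t $ p - solution (\<lambda>_. B) \<alpha> u 0 t $ q) \<longlonglongrightarrow> 0"
  unfolding separates_def limsup_abs_pos_iff by blast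

lemma AE_cluster_consensus:
  fixes A :: "nat \<Rightarrow> real^'n::finite^'n" and C :: "'k::finite \<Rightarrow> 'n set"
  assumes A: "admissible C \<Upsilon> B A" and C: "clustering C" and T: "0 < T"
    and sep: "separates B \<alpha> (periodic_input T w)"
  shows "AE x0 in lborel. cluster_consensus C (solution A (cluster_vector C \<alpha>) (periodic_input T w) x0)"
proof -
  let ?u = "periodic_input T w"
  let ?x = "solution A (cluster_vector C \<alpha>) ?u"
  have "(\<Sum>k\<le>t + T. ?u k) = (\<Sum>k\<le>t. ?u k)" for t
    using periodic_partial_sums[of ?u T "Suc t", OF periodic_input_periodic periodic_input_zero_sum[OF T]]
    by (simp add: lessThan_Suc_atMost)
  then have sums: "bounded (range (\<lambda>t. \<Sum>k\<le>t. ?u k))"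
    by (intro periodic_bounded[OF _ T])
  have bdd: "bounded (range (?x x0))" for x0
    by (intro solution_bounded[OF A C _ sums] periodic_bounded[OF _ T] periodic_input_periodic)
  have "AE x0 in lborel. p \<noteq> q \<longrightarrow> i \<in> C p \<longrightarrow> j \<in> C q \<longrightarrow> \<not> (\<lambda>t. ?x x0 t $ i - ?x x0 t $ j) \<longlonglongrightarrow> 0"
    for p q i j
  proof (cases "p \<noteq> q \<and> i \<in> C p \<and> j \<in> C q")
    case True
    then show ?thesis
      using AE_solution_separates[OF A C _ _ separatesD[OF sep], of i p j q] by auto
  qed auto
  then have "AE x0 in lborel. \<forall>p q i j. p \<noteq> q \<longrightarrow> i \<in> C p \<longrightarrow> j \<in> C q \<longrightarrow>
      \<not> (\<lambda>t. ?x x0 t $ i - ?x x0 t $ j) \<longlonglongrightarrow> 0"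
    unfolding AE_all_countable by blast
  then show ?thesis
  proof eventually_elim
    case (elim x0)
    then have "inter_cluster_separates C (?x x0)"
      unfolding inter_cluster_separates_def limsup_abs_pos_iff by blast
    then show ?case
      using bdd solution_intra_cluster_synchronizes[OF A C] by (simp add: cluster_consensus_def)
  qed
qed

section \<open>Measurability and null sets of triples\<close>

lemma measurable_solution_component:
  assumes B: "\<And>p q. (\<lambda>z. B z $ p $ q) \<in> borel_measurable M"
    and \<alpha>: "\<And>p. (\<lambda>z. \<alpha> z $ p) \<in> borel_measurable M"
    and u: "\<And>t. (\<lambda>z. u z t) \<in> borel_measurable M"
  shows "(\<lambda>z. solution (\<lambda>_. B z) (\<alpha> z) (u z) 0 t $ p) \<in> borel_measurable M"
proof (induction t arbitrary: p)
  case (Suc t)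
  note [measurable] = B \<alpha> u Suc
  show ?case by (simp add: matrix_vector_mult_def)
qed simp

lemma measurable_separates:
  assumes "\<And>p q. (\<lambda>z. B z $ p $ q) \<in> borel_measurable M"
    and "\<And>p. (\<lambda>z. \<alpha> z $ p) \<in> borel_measurable M"
    and "\<And>t. (\<lambda>z. u z t) \<in> borel_measurable M"
  shows "{z \<in> space M. separates (B z) (\<alpha> z) (u z)} \<in> sets M"
proof -
  note [measurable] = measurable_solution_component[OF assms]
  show ?thesis unfolding separates_def by measurable
qed

lemma measurable_periodic_input:
  assumes "0 < T"
  shows "(\<lambda>w. periodic_input T w t) \<in> borel_measurable (\<Pi>\<^sub>M j\<in>{1..<T}. lborel)"
proof (cases "t mod T = 0")
  case True
  then show ?thesis unfolding periodic_input_def by simp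
next
  case False
  then have "t mod T \<in> {1..<T}" using assms by simp
  then show ?thesis using False unfolding periodic_input_def by simp
qed

text \<open>The exceptional set is a box whose side in direction i is the null set {0}.\<close>

lemma AE_PiM_lborel_nonzero:
  assumes "finite I" "i \<in> I"
  shows "AE w in (\<Pi>\<^sub>M j\<in>I. (lborel :: real measure)). w i \<noteq> 0"
proof -
  interpret product_sigma_finite "\<lambda>_. lborel :: real measure" ..
  have "emeasure (\<Pi>\<^sub>M j\<in>I. (lborel :: real measure)) (\<Pi>\<^sub>E j\<in>I. if j = i then {0} else UNIV)
      = (\<Prod>j\<in>I. emeasure lborel (if j = i then {0::real} else UNIV))"
    using assms(1) by (intro emeasure_PiM) auto
  also have "\<dots> = 0" using assms by (intro prod_zero bexI[of _ i]) auto
  finally have "(\<Pi>\<^sub>E j\<in>I. if j = i then {0} else UNIV) \<in> null_sets (\<Pi>\<^sub>M j\<in>I. (lborel :: real measure))"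
    using assms(1) by (intro null_setsI) (auto intro!: sets_PiM_I_finite)
  moreover have "{w \<in> space (\<Pi>\<^sub>M j\<in>I. (lborel :: real measure)). \<not> w i \<noteq> 0}
      \<subseteq> (\<Pi>\<^sub>E j\<in>I. if j = i then {0} else UNIV)"
    by (auto simp: space_PiM PiE_iff extensional_def)
  ultimately show ?thesis by (rule AE_I')
qed

text \<open>All sections of the exceptional set are null, so its measure is the integral of 0.
  Sigma-finiteness is asked of the second factor alone, so the first can be
  \<open>affine_lborel\<close>.\<close>

lemma AE_pair_measureI:
  assumes "sigma_finite_measure N"
    and meas: "{z \<in> space (M \<Otimes>\<^sub>M N). P z} \<in> sets (M \<Otimes>\<^sub>M N)"
    and ae: "\<And>x. x \<in> space M \<Longrightarrow> AE y in N. P (x, y)"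
  shows "AE z in M \<Otimes>\<^sub>M N. P z"
proof -
  interpret sigma_finite_measure N by fact
  define X where "X = {z \<in> space (M \<Otimes>\<^sub>M N). \<not> P z}"
  have X: "X \<in> sets (M \<Otimes>\<^sub>M N)" unfolding X_def by (intro sets.sets_Collect meas)
  have "emeasure N (Pair x -` X) = 0" if "x \<in> space M" for x
  proof -
    have eq: "{y \<in> space N. \<not> P (x, y)} = Pair x -` X"
      using that by (auto simp: X_def space_pair_measure)
    show ?thesis
      using AE_iff_measurable[OF sets_Pair1[OF X] eq] ae[OF that] by blast
  qed
  then have "(\<integral>\<^sup>+x. emeasure N (Pair x -` X) \<partial>M) = (\<integral>\<^sup>+x. 0 \<partial>M)"
    by (intro nn_integral_cong)
  then have "emeasure (M \<Otimes>\<^sub>M N) X = 0"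
    unfolding emeasure_pair_measure_alt[OF X] by simp
  then show ?thesis using X by (intro AE_I'[of X] null_setsI) (auto simp: X_def)
qed

text \<open>For each fixed B, the input is fixed first, with w 1 nonzero, and then almost every
  \<alpha> separates; Fubini assembles these statements.\<close>

lemma AE_separates:
  fixes M :: "(real^'k::finite^'k) measure" and T :: nat
  assumes M: "sets M = sets borel" and T: "2 \<le> T"
  shows "AE (B, \<alpha>, w) in M \<Otimes>\<^sub>M ((lborel :: (real^'k) measure) \<Otimes>\<^sub>M (\<Pi>\<^sub>M j\<in>{1..<T}. (lborel :: real measure))).
    separates B \<alpha> (periodic_input T w)"
proof -
  let ?W = "\<Pi>\<^sub>M j\<in>{1..<T}. (lborel :: real measure)"
  interpret W: finite_product_sigma_finite "\<lambda>_. lborel :: real measure" "{1..<T}"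
    by standard simp
  interpret P: pair_sigma_finite "lborel :: (real^'k) measure" ?W ..
  have T0: "0 < T" using T by simp
  note [measurable] = measurable_periodic_input[OF T0]
  have comp: "(\<lambda>B::real^'k^'k. B $ p $ q) \<in> borel_measurable borel" for p q
    by (intro borel_measurable_continuous_onI continuous_intros)
  have "(\<lambda>B::real^'k^'k. B $ p $ q) \<in> borel_measurable M" for p q
    using comp M by (simp cong: measurable_cong_sets)
  note [measurable] = this
  have [measurable]: "(\<lambda>\<alpha>::real^'k. \<alpha> $ p) \<in> borel_measurable borel" for p
    by (intro borel_measurable_continuous_onI continuous_intros)
  show ?thesis
    unfolding split_beta
  proof (rule AE_pair_measureI[OF P.sigma_finite_measure_axioms])
    show "{z \<in> space (M \<Otimes>\<^sub>M (lborel \<Otimes>\<^sub>M ?W)). separates (fst z) (fst (snd z)) (periodic_input T (snd (snd z)))}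
        \<in> sets (M \<Otimes>\<^sub>M (lborel \<Otimes>\<^sub>M ?W))"
      by (intro measurable_separates) measurable
  next
    fix B :: "real^'k^'k" assume "B \<in> space M"
    have meas: "{z \<in> space (lborel \<Otimes>\<^sub>M ?W). separates B (fst z) (periodic_input T (snd z))}
        \<in> sets (lborel \<Otimes>\<^sub>M ?W)"
      by (intro measurable_separates) measurable
    have w1: "AE w in ?W. w 1 \<noteq> 0" using T by (intro AE_PiM_lborel_nonzero) auto
    have "AE w in ?W. AE \<alpha> in lborel. separates B \<alpha> (periodic_input T w)"
      using w1
    proof eventually_elim
      case (elim w)
      \<comment> \<open>T \<ge> 2 gives 1 mod T = 1, so the input at time 1 is the free coordinate w
        1.\<close>
      have u1: "periodic_input T w 1 \<noteq> 0" using elim T by (simp add: periodic_input_def)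
      have "AE \<alpha> in lborel. p \<noteq> q \<longrightarrow> 0 < limsup (\<lambda>t. ereal
          \<bar>solution (\<lambda>_. B) \<alpha> (periodic_input T w) 0 t $ p
            - solution (\<lambda>_. B) \<alpha> (periodic_input T w) 0 t $ q\<bar>)" for p q
        unfolding limsup_abs_pos_iff
        using AE_forced_response_separates[of p q "periodic_input T w" T B,
            OF _ periodic_input_periodic T0 u1]
        by (cases "p = q") auto
      then show ?case unfolding separates_def AE_all_countable by blast
    qed
    \<comment> \<open>The product measure has \<alpha> before w, the reverse of the order in which
      the null sets were found.\<close>
    then have "AE \<alpha> in lborel. AE w in ?W. separates B \<alpha> (periodic_input T w)"
      using P.AE_commute[of "\<lambda>\<alpha> w. separates B \<alpha> (periodic_input T w)", OF meas] by blast
    then show "AE y in lborel \<Otimes>\<^sub>M ?W. separates (fst (B, y)) (fst (snd (B, y)))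
        (periodic_input T (snd (snd (B, y))))"
      using meas by (intro P.AE_pair_measure) auto
  qed
qed

lemma sets_affine_lborel: "sets (affine_lborel H) = sets borel"
  by (simp add: affine_lborel_def Let_def)

theorem theorem4:
  fixes C :: "'k::finite \<Rightarrow> ('n::finite) set" and \<Upsilon> :: "('n \<times> 'n) set set"
  assumes "clustering C" and "finite \<Upsilon>" and "common_inter_links C \<Upsilon>"
  shows
    "(\<forall>(B :: real^'k^'k) A (\<alpha> :: real^'k) u.
        admissible C \<Upsilon> B A \<and> bounded (range u) \<and> bounded (range (\<lambda>t. \<Sum>k\<le>t. u k)) \<longrightarrow>
        (\<forall>x0. bounded (range (solution A (cluster_vector C \<alpha>) u x0)))) \<and>
     (\<forall>T::nat\<ge>2.
        (AE (B, \<alpha>, w) in affine_lborel (affine hull (pattern_matrices C \<Upsilon>)) \<Otimes>\<^sub>M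
             ((lborel :: (real^'k) measure) \<Otimes>\<^sub>M (\<Pi>\<^sub>M j\<in>{1..<T}. (lborel :: real measure))).
           B \<in> pattern_matrices C \<Upsilon> \<longrightarrow>
           (\<forall>A. admissible C \<Upsilon> B A \<longrightarrow>
             (AE x0 in lborel.
                cluster_consensus C
                  (solution A (cluster_vector C \<alpha>) (periodic_input T w) x0)))) \<and>
        (\<forall>(B :: real^'k^'k) A (\<alpha> :: real^'k) u.
           admissible C \<Upsilon> B A \<and> (\<forall>t. u (t + T) = u t) \<and> (\<Sum>k=1..T. u k) = 0 \<longrightarrow>
           (\<forall>x0. \<exists>v :: nat \<Rightarrow> real^'n. (\<forall>t. v (t + T) = v t) \<and>
              (\<lambda>t. norm (solution A (cluster_vector C \<alpha>) u x0 t - v t)) \<longlonglongrightarrow> 0)))"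
proof (intro conjI allI impI; (elim conjE)?)
  fix B :: "real^'k^'k" and A and \<alpha> :: "real^'k" and u :: "nat \<Rightarrow> real" and x0
  assume "admissible C \<Upsilon> B A" "bounded (range u)" "bounded (range (\<lambda>t. \<Sum>k\<le>t. u k))"
  then show "bounded (range (solution A (cluster_vector C \<alpha>) u x0))"
    by (intro solution_bounded assms(1))
next
  fix T :: nat assume T: "2 \<le> T"
  show "AE (B, \<alpha>, w) in affine_lborel (affine hull (pattern_matrices C \<Upsilon>)) \<Otimes>\<^sub>M
             ((lborel :: (real^'k) measure) \<Otimes>\<^sub>M (\<Pi>\<^sub>M j\<in>{1..<T}. (lborel :: real measure))).
           B \<in> pattern_matrices C \<Upsilon> \<longrightarrow>
           (\<forall>A. admissible C \<Upsilon> B A \<longrightarrow>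
             (AE x0 in lborel.
                cluster_consensus C
                  (solution A (cluster_vector C \<alpha>) (periodic_input T w) x0)))"
    \<comment> \<open>Off the null set where \<open>separates\<close> fails, the conclusion holds
      for every admissible A.\<close>
    using AE_separates[OF sets_affine_lborel T]
    by eventually_elim (use T in \<open>auto intro: AE_cluster_consensus[OF _ assms(1)]\<close>)
next
  fix T :: nat and B :: "real^'k^'k" and A and \<alpha> :: "real^'k" and u :: "nat \<Rightarrow> real" and x0
  assume "2 \<le> T" "admissible C \<Upsilon> B A" "\<forall>t. u (t + T) = u t" "(\<Sum>k=1..T. u k) = 0"
  then show "\<exists>v :: nat \<Rightarrow> real^'n. (\<forall>t. v (t + T) = v t) \<and>
      (\<lambda>t. norm (solution A (cluster_vector C \<alpha>) u x0 t - v t)) \<longlonglongrightarrow> 0"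
    by (intro solution_asymptotically_periodic[OF _ assms(1)]) auto
qed

end
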